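(* If $G$ is a finitely generated virtually nilpotent group, then $\mathfrak{X}(G)$ is virtually nilpotent.
   Context: For a group $G$, let $\overline{G}$ be a second copy of $G$ with a fixed isomorphism $g\mapsto\overline{g}$. The group $\mathfrak{X}(G)$ is the quotient of the free product $G\ast\overline{G}$ by the normal closure of $\{[g,\overline{g}] : g\in G\}$. *)

theory Defs
  imports "HOL-Algebra.Generated_Groups"
begin

section \<open>Free products of two groups\<close>

text \<open>The free product is the set of words in the disjoint union of the two carriers, modulo
  deleting identity letters and multiplying adjacent letters from the same factor.\<close>

definition fp_words :: "('a, 'c) monoid_scheme \<Rightarrow> ('b, 'd) monoid_scheme \<Rightarrow> ('a + 'b) list set" where
  "fp_words G H = lists (carrier G <+> carrier H)"

inductive fp_step :: "('a, 'c) monoid_scheme \<Rightarrow> ('b, 'd) monoid_scheme \<Rightarrow>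
    ('a + 'b) list \<Rightarrow> ('a + 'b) list \<Rightarrow> bool"
  for G and H where
  one_left: "\<lbrakk>us \<in> fp_words G H; vs \<in> fp_words G H\<rbrakk>
    \<Longrightarrow> fp_step G H (us @ Inl \<one>\<^bsub>G\<^esub> # vs) (us @ vs)"
| one_right: "\<lbrakk>us \<in> fp_words G H; vs \<in> fp_words G H\<rbrakk>
    \<Longrightarrow> fp_step G H (us @ Inr \<one>\<^bsub>H\<^esub> # vs) (us @ vs)"
| mult_left: "\<lbrakk>us \<in> fp_words G H; vs \<in> fp_words G H; x \<in> carrier G; y \<in> carrier G\<rbrakk>
    \<Longrightarrow> fp_step G H (us @ Inl x # Inl y # vs) (us @ Inl (x \<otimes>\<^bsub>G\<^esub> y) # vs)"
| mult_right: "\<lbrakk>us \<in> fp_words G H; vs \<in> fp_words G H; x \<in> carrier H; y \<in> carrier H\<rbrakk>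
    \<Longrightarrow> fp_step G H (us @ Inr x # Inr y # vs) (us @ Inr (x \<otimes>\<^bsub>H\<^esub> y) # vs)"

definition fp_rel :: "('a, 'c) monoid_scheme \<Rightarrow> ('b, 'd) monoid_scheme \<Rightarrow>
    (('a + 'b) list \<times> ('a + 'b) list) set" where
  "fp_rel G H = {(u, v). u \<in> fp_words G H \<and> v \<in> fp_words G H \<and> equivclp (fp_step G H) u v}"

definition free_product :: "('a, 'c) monoid_scheme \<Rightarrow> ('b, 'd) monoid_scheme \<Rightarrow>
    ('a + 'b) list set monoid" where
  "free_product G H =
    \<lparr>carrier = fp_words G H // fp_rel G H,
     mult = (\<lambda>X Y. \<Union>u\<in>X. \<Union>v\<in>Y. fp_rel G H `` {u @ v}),
     one = fp_rel G H `` {[]}\<rparr>"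

definition fp_inl :: "('a, 'c) monoid_scheme \<Rightarrow> ('b, 'd) monoid_scheme \<Rightarrow> 'a \<Rightarrow> ('a + 'b) list set" where
  "fp_inl G H x = fp_rel G H `` {[Inl x]}"

definition fp_inr :: "('a, 'c) monoid_scheme \<Rightarrow> ('b, 'd) monoid_scheme \<Rightarrow> 'b \<Rightarrow> ('a + 'b) list set" where
  "fp_inr G H y = fp_rel G H `` {[Inr y]}"


section \<open>Normal closures and the group X(G)\<close>

definition commutator :: "('a, 'b) monoid_scheme \<Rightarrow> 'a \<Rightarrow> 'a \<Rightarrow> 'a" where
  "commutator G x y = x \<otimes>\<^bsub>G\<^esub> y \<otimes>\<^bsub>G\<^esub> inv\<^bsub>G\<^esub> x \<otimes>\<^bsub>G\<^esub> inv\<^bsub>G\<^esub> y"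

definition normal_closure :: "('a, 'b) monoid_scheme \<Rightarrow> 'a set \<Rightarrow> 'a set" where
  "normal_closure G S = \<Inter>{N. N \<lhd> G \<and> S \<subseteq> N}"

text \<open>Since the two factors of a free product are tagged by \<open>Inl\<close> and \<open>Inr\<close>, the second copy of
  \<open>G\<close> is the right factor of \<open>G * G\<close>, and \<open>fp_inr G G g\<close> is the element written as \<open>g\<close> with a bar.\<close>

definition weak_comm_relators :: "('a, 'b) monoid_scheme \<Rightarrow> ('a + 'a) list set set" where
  "weak_comm_relators G =
    {commutator (free_product G G) (fp_inl G G g) (fp_inr G G g) | g. g \<in> carrier G}"

definition weak_comm_group :: "('a, 'b) monoid_scheme \<Rightarrow> ('a + 'a) list set set monoid" where
  "weak_comm_group G =
    free_product G G Mod normal_closure (free_product G G) (weak_comm_relators G)"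


section \<open>Finite generation and virtual nilpotency\<close>

definition finitely_generated_group :: "('a, 'b) monoid_scheme \<Rightarrow> bool" where
  "finitely_generated_group G \<longleftrightarrow>
    group G \<and> (\<exists>S. finite S \<and> S \<subseteq> carrier G \<and> generate G S = carrier G)"

primrec lower_central :: "('a, 'b) monoid_scheme \<Rightarrow> nat \<Rightarrow> 'a set" where
  "lower_central G 0 = carrier G"
| "lower_central G (Suc n) =
    generate G {commutator G x y | x y. x \<in> lower_central G n \<and> y \<in> carrier G}"

definition nilpotent_group :: "('a, 'b) monoid_scheme \<Rightarrow> bool" where
  "nilpotent_group G \<longleftrightarrow> group G \<and> (\<exists>n. lower_central G n = {\<one>\<^bsub>G\<^esub>})"

definition virtually_nilpotent_group :: "('a, 'b) monoid_scheme \<Rightarrow> bool" where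
  "virtually_nilpotent_group G \<longleftrightarrow> group G \<and>
    (\<exists>H. subgroup H G \<and> finite (rcosets\<^bsub>G\<^esub> H) \<and> nilpotent_group (G\<lparr>carrier := H\<rparr>))"


section \<open>Basic facts about the constructions\<close>

lemma fp_words_simps [simp]:
  "[] \<in> fp_words G H"
  "Inl x # w \<in> fp_words G H \<longleftrightarrow> x \<in> carrier G \<and> w \<in> fp_words G H"
  "Inr y # w \<in> fp_words G H \<longleftrightarrow> y \<in> carrier H \<and> w \<in> fp_words G H"
  "u @ v \<in> fp_words G H \<longleftrightarrow> u \<in> fp_words G H \<and> v \<in> fp_words G H"
  by (auto simp: fp_words_def)

lemma fp_step_append:
  assumes "fp_step G H u v" "a \<in> fp_words G H" "b \<in> fp_words G H"
  shows "fp_step G H (a @ u @ b) (a @ v @ b)"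
  using assms(1)
proof cases
  case (one_left us vs)
  then show ?thesis
    using fp_step.one_left[of "a @ us" G H "vs @ b"] assms by simp
next
  case (one_right us vs)
  then show ?thesis
    using fp_step.one_right[of "a @ us" G H "vs @ b"] assms by simp
next
  case (mult_left us vs x y)
  then show ?thesis
    using fp_step.mult_left[of "a @ us" G H "vs @ b" x y] assms by simp
next
  case (mult_right us vs x y)
  then show ?thesis
    using fp_step.mult_right[of "a @ us" G H "vs @ b" x y] assms by simp
qed

lemma equivclp_fp_step_append:
  assumes "equivclp (fp_step G H) u v" "a \<in> fp_words G H" "b \<in> fp_words G H"
  shows "equivclp (fp_step G H) (a @ u @ b) (a @ v @ b)"
  using assms(1)
proof (induction rule: equivclp_induct)
  case base
  show ?case by simp
next
  case (step y z)
  have "equivclp (fp_step G H) (a @ y @ b) (a @ z @ b)"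
    using step.hyps(2) fp_step_append[OF _ assms(2,3)]
    by (metis r_into_equivclp converse_r_into_equivclp)
  with step.IH show ?case by (rule equivclp_trans)
qed

lemma equiv_fp_rel: "equiv (fp_words G H) (fp_rel G H)"
  unfolding fp_rel_def
  by (rule equivI) (auto simp: refl_on_def sym_def trans_def intro: equivclp_sym equivclp_trans)

lemma fp_rel_append:
  assumes "(u, u') \<in> fp_rel G H" "(v, v') \<in> fp_rel G H"
  shows "(u @ v, u' @ v') \<in> fp_rel G H"
proof -
  have w: "u \<in> fp_words G H" "u' \<in> fp_words G H" "v \<in> fp_words G H" "v' \<in> fp_words G H"
    and e: "equivclp (fp_step G H) u u'" "equivclp (fp_step G H) v v'"
    using assms by (auto simp: fp_rel_def)
  have "equivclp (fp_step G H) ([] @ u @ v) ([] @ u' @ v)"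
    by (rule equivclp_fp_step_append[OF e(1)]) (use w in auto)
  moreover have "equivclp (fp_step G H) (u' @ v @ []) (u' @ v' @ [])"
    by (rule equivclp_fp_step_append[OF e(2)]) (use w in auto)
  ultimately show ?thesis
    using w by (auto simp: fp_rel_def intro: equivclp_trans)
qed

lemma fp_class_eq_iff:
  assumes "u \<in> fp_words G H" "v \<in> fp_words G H"
  shows "fp_rel G H `` {u} = fp_rel G H `` {v} \<longleftrightarrow> equivclp (fp_step G H) u v"
  using eq_equiv_class_iff[OF equiv_fp_rel assms] assms by (simp add: fp_rel_def)

lemma free_product_mult:
  assumes "u \<in> fp_words G H" "v \<in> fp_words G H"
  shows "(fp_rel G H `` {u}) \<otimes>\<^bsub>free_product G H\<^esub> (fp_rel G H `` {v}) = fp_rel G H `` {u @ v}"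
proof -
  have "(\<Union>u'\<in>fp_rel G H `` {u}. \<Union>v'\<in>fp_rel G H `` {v}. fp_rel G H `` {u' @ v'}) = fp_rel G H `` {u @ v}"
  proof (rule UN_equiv_class2[OF equiv_fp_rel equiv_fp_rel _ assms])
    show "congruent2 (fp_rel G H) (fp_rel G H) (\<lambda>u v. fp_rel G H `` {u @ v})"
      by (rule congruent2I') (auto intro!: equiv_class_eq[OF equiv_fp_rel] fp_rel_append)
  qed
  then show ?thesis by (simp add: free_product_def)
qed

lemma free_product_carrier: "carrier (free_product G H) = (\<lambda>w. fp_rel G H `` {w}) ` fp_words G H"
  by (auto simp: free_product_def quotient_def)

lemma free_product_one: "\<one>\<^bsub>free_product G H\<^esub> = fp_rel G H `` {[]}"
  by (simp add: free_product_def)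

lemma free_product_left_inverse:
  assumes "group G" "group H" "w \<in> fp_words G H"
  shows "\<exists>v\<in>fp_words G H. equivclp (fp_step G H) (v @ w) []"
  using assms(3)
proof (induction w)
  case Nil
  show ?case by (rule bexI[of _ "[]"]) auto
next
  case (Cons z w)
  have w: "w \<in> fp_words G H" using Cons.prems by (cases z) auto
  then obtain v where v: "v \<in> fp_words G H" "equivclp (fp_step G H) (v @ w) []"
    using Cons.IH by blast
  show ?case
  proof (cases z)
    case (Inl x)
    then have x: "x \<in> carrier G" "inv\<^bsub>G\<^esub> x \<in> carrier G" using Cons.prems assms(1) by auto
    have "fp_step G H (v @ Inl (inv\<^bsub>G\<^esub> x) # Inl x # w) (v @ Inl (inv\<^bsub>G\<^esub> x \<otimes>\<^bsub>G\<^esub> x) # w)"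
      using v w x by (intro fp_step.mult_left) auto
    moreover have "fp_step G H (v @ Inl (inv\<^bsub>G\<^esub> x \<otimes>\<^bsub>G\<^esub> x) # w) (v @ w)"
      using fp_step.one_left[of v G H w] v w x assms(1) by (simp add: group.l_inv)
    ultimately have "equivclp (fp_step G H) (v @ Inl (inv\<^bsub>G\<^esub> x) # Inl x # w) []"
      using v(2) by (meson r_into_equivclp equivclp_trans)
    then show ?thesis
      using Inl v x by (intro bexI[of _ "v @ [Inl (inv\<^bsub>G\<^esub> x)]"]) auto
  next
    case (Inr x)
    then have x: "x \<in> carrier H" "inv\<^bsub>H\<^esub> x \<in> carrier H" using Cons.prems assms(2) by auto
    have "fp_step G H (v @ Inr (inv\<^bsub>H\<^esub> x) # Inr x # w) (v @ Inr (inv\<^bsub>H\<^esub> x \<otimes>\<^bsub>H\<^esub> x) # w)"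
      using v w x by (intro fp_step.mult_right) auto
    moreover have "fp_step G H (v @ Inr (inv\<^bsub>H\<^esub> x \<otimes>\<^bsub>H\<^esub> x) # w) (v @ w)"
      using fp_step.one_right[of v G H w] v w x assms(2) by (simp add: group.l_inv)
    ultimately have "equivclp (fp_step G H) (v @ Inr (inv\<^bsub>H\<^esub> x) # Inr x # w) []"
      using v(2) by (meson r_into_equivclp equivclp_trans)
    then show ?thesis
      using Inr v x by (intro bexI[of _ "v @ [Inr (inv\<^bsub>H\<^esub> x)]"]) auto
  qed
qed

theorem group_free_product:
  assumes "group G" "group H"
  shows "group (free_product G H)"
proof (rule groupI)
  fix X assume "X \<in> carrier (free_product G H)"
  then obtain w where w: "w \<in> fp_words G H" "X = fp_rel G H `` {w}"
    by (auto simp: free_product_carrier)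
  obtain v where "v \<in> fp_words G H" "equivclp (fp_step G H) (v @ w) []"
    using free_product_left_inverse[OF assms w(1)] by blast
  with w show "\<exists>Y\<in>carrier (free_product G H). Y \<otimes>\<^bsub>free_product G H\<^esub> X = \<one>\<^bsub>free_product G H\<^esub>"
    by (auto simp: free_product_carrier free_product_mult free_product_one fp_class_eq_iff)
qed (auto simp: free_product_carrier free_product_mult free_product_one)

lemma fp_inl_hom:
  assumes "group G"
  shows "fp_inl G H \<in> hom G (free_product G H)"
proof (rule homI)
  fix x y assume xy: "x \<in> carrier G" "y \<in> carrier G"
  then have "fp_step G H [Inl x, Inl y] [Inl (x \<otimes>\<^bsub>G\<^esub> y)]"
    using fp_step.mult_left[of "[]" G H "[]" x y] by simp
  then show "fp_inl G H (x \<otimes>\<^bsub>G\<^esub> y) = fp_inl G H x \<otimes>\<^bsub>free_product G H\<^esub> fp_inl G H y"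
    using xy assms
    by (simp add: fp_inl_def free_product_mult fp_class_eq_iff group.is_monoid monoid.m_closed
        converse_r_into_equivclp)
qed (auto simp: fp_inl_def free_product_carrier)

lemma fp_inr_hom:
  assumes "group H"
  shows "fp_inr G H \<in> hom H (free_product G H)"
proof (rule homI)
  fix x y assume xy: "x \<in> carrier H" "y \<in> carrier H"
  then have "fp_step G H [Inr x, Inr y] [Inr (x \<otimes>\<^bsub>H\<^esub> y)]"
    using fp_step.mult_right[of "[]" G H "[]" x y] by simp
  then show "fp_inr G H (x \<otimes>\<^bsub>H\<^esub> y) = fp_inr G H x \<otimes>\<^bsub>free_product G H\<^esub> fp_inr G H y"
    using xy assms
    by (simp add: fp_inr_def free_product_mult fp_class_eq_iff group.is_monoid monoid.m_closed
        converse_r_into_equivclp)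
qed (auto simp: fp_inr_def free_product_carrier)

primrec fp_eval :: "('k, 'e) monoid_scheme \<Rightarrow> ('a \<Rightarrow> 'k) \<Rightarrow> ('b \<Rightarrow> 'k) \<Rightarrow> ('a + 'b) list \<Rightarrow> 'k" where
  "fp_eval K f g [] = \<one>\<^bsub>K\<^esub>"
| "fp_eval K f g (z # w) = case_sum f g z \<otimes>\<^bsub>K\<^esub> fp_eval K f g w"

theorem free_product_universal:
  assumes "group G" "group H" "group K" "f \<in> hom G K" "g \<in> hom H K"
  obtains h where "h \<in> hom (free_product G H) K"
    and "\<And>x. x \<in> carrier G \<Longrightarrow> h (fp_inl G H x) = f x"
    and "\<And>y. y \<in> carrier H \<Longrightarrow> h (fp_inr G H y) = g y"
proof -
  interpret K: group K by fact
  interpret f: group_hom G K f using assms by (simp add: group_hom_def group_hom_axioms_def)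
  interpret g: group_hom H K g using assms by (simp add: group_hom_def group_hom_axioms_def)
  have cl: "fp_eval K f g w \<in> carrier K" if "w \<in> fp_words G H" for w
    using that
  proof (induction w)
    case (Cons z w)
    then show ?case by (cases z) auto
  qed auto
  have app: "fp_eval K f g (u @ v) = fp_eval K f g u \<otimes>\<^bsub>K\<^esub> fp_eval K f g v"
    if "u \<in> fp_words G H" "v \<in> fp_words G H" for u v
    using that
  proof (induction u)
    case (Cons z u)
    then show ?case by (cases z) (auto simp: cl K.m_assoc)
  qed (auto simp: cl)
  have step: "fp_eval K f g u = fp_eval K f g v" if "fp_step G H u v" for u v
    using that by cases (auto simp: app cl K.m_assoc)
  have eqv: "fp_eval K f g u = fp_eval K f g v" if "equivclp (fp_step G H) u v" for u v
    using that by (induction rule: equivclp_induct) (auto dest: step)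
  define h where "h X = the_elem (fp_eval K f g ` X)" for X
  have h: "h (fp_rel G H `` {w}) = fp_eval K f g w" if "w \<in> fp_words G H" for w
  proof -
    have "fp_eval K f g ` (fp_rel G H `` {w}) = {fp_eval K f g w}"
      using that eqv by (auto simp: fp_rel_def image_iff intro!: exI[of _ w])
    then show ?thesis by (simp add: h_def)
  qed
  show thesis
  proof (rule that)
    show "h \<in> hom (free_product G H) K"
      by (rule homI) (auto simp: free_product_carrier free_product_mult h cl app)
  qed (auto simp: fp_inl_def fp_inr_def h)
qed

lemma free_product_generated:
  assumes "group G" "group H"
  shows "generate (free_product G H) (fp_inl G H ` carrier G \<union> fp_inr G H ` carrier H)
    = carrier (free_product G H)"
    (is "generate ?P ?S = _")
proof
  interpret P: group ?P using group_free_product[OF assms] .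
  have "?S \<subseteq> carrier ?P"
    using fp_inl_hom[OF assms(1), of H] fp_inr_hom[OF assms(2), of G] by (auto simp: hom_def)
  then show "generate ?P ?S \<subseteq> carrier ?P" by (rule P.generate_incl)
  have "fp_rel G H `` {w} \<in> generate ?P ?S" if "w \<in> fp_words G H" for w
    using that
  proof (induction w)
    case Nil
    show ?case using generate.one[of ?P ?S] by (simp add: free_product_one)
  next
    case (Cons z w)
    have z: "[z] \<in> fp_words G H" and w: "w \<in> fp_words G H"
      using Cons.prems by (cases z; simp)+
    have "fp_rel G H `` {[z]} \<in> generate ?P ?S"
      using z by (cases z) (auto simp: fp_inl_def fp_inr_def intro!: generate.incl)
    then have "fp_rel G H `` {[z]} \<otimes>\<^bsub>?P\<^esub> fp_rel G H `` {w} \<in> generate ?P ?S"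
      using Cons.IH[OF w] by (rule generate.eng)
    then show ?case by (simp add: free_product_mult z w)
  qed
  then show "carrier ?P \<subseteq> generate ?P ?S" by (auto simp: free_product_carrier)
qed

lemma normal_closure_normal:
  assumes "group G" "S \<subseteq> carrier G"
  shows "normal_closure G S \<lhd> G"
proof -
  interpret group G by fact
  have N: "subgroup N G" "\<And>x n. \<lbrakk>x \<in> carrier G; n \<in> N\<rbrakk> \<Longrightarrow> x \<otimes>\<^bsub>G\<^esub> n \<otimes>\<^bsub>G\<^esub> inv\<^bsub>G\<^esub> x \<in> N" if "N \<lhd> G" for N
    using that by (auto simp: normal_inv_iff)
  have "carrier G \<lhd> G" by (intro normal_invI subgroup_self) auto
  then have "{N. N \<lhd> G \<and> S \<subseteq> N} \<noteq> {}" using assms by blast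
  then have "subgroup (normal_closure G S) G"
    unfolding normal_closure_def by (intro subgroups_Inter) (auto dest: N)
  then show ?thesis
    by (rule normal_invI) (auto simp: normal_closure_def intro: N)
qed

lemma weak_comm_relators_subset:
  assumes "group G"
  shows "weak_comm_relators G \<subseteq> carrier (free_product G G)"
proof -
  interpret P: group "free_product G G" using group_free_product[OF assms assms] .
  have "fp_inl G G g \<in> carrier (free_product G G)" "fp_inr G G g \<in> carrier (free_product G G)"
    if "g \<in> carrier G" for g
    using that fp_inl_hom[OF assms, of G] fp_inr_hom[OF assms, of G] by (auto simp: hom_def)
  then show ?thesis by (auto simp: weak_comm_relators_def commutator_def)
qed

theorem group_weak_comm_group:
  assumes "group G"
  shows "group (weak_comm_group G)"
  unfolding weak_comm_group_def
  by (intro normal.factorgroup_is_group normal_closure_normal group_free_product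
      weak_comm_relators_subset assms)

end

theory Submission
  imports Defs
begin

text \<open>Let \<open>X\<close> be generated by two copies \<open>f\<close>, \<open>f'\<close> of \<open>G\<close>, with \<open>q : X \<rightarrow> G\<close> the retraction of both
  copies and \<open>p\<close>, \<open>r\<close> the retractions killing one of them. The kernel of \<open>q\<close> is
  \<open>L = \<langle>f'(k) f(k)\<^sup>-\<^sup>1\<rangle>\<close>; the intersection of the kernels of \<open>p\<close> and \<open>r\<close> is \<open>D = [f G, f' G]\<close>, and
  \<open>D\<close> commutes with \<open>L\<close>. So \<open>W = L \<inter> D\<close> is central in \<open>L\<close>, and \<open>X / W\<close> embeds into \<open>G\<^sup>3\<close>.

  If \<open>K\<close> is a nilpotent normal subgroup of finite index in \<open>G\<close>, its preimage \<open>Y\<close> in \<open>X\<close> is nilpotent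
  modulo \<open>W\<close>, and it remains to see that \<open>Y\<close> acts nilpotently on \<open>W\<close>. On \<open>L / [L, L]\<close>, which has
  the relations of the augmentation ideal modulo the elements \<open>(g - 1)\<^sup>2 k\<close>, every \<open>g\<close> acts with
  \<open>(g - 1)\<^sup>2 = 0\<close>, and for a finitely generated group this makes the action nilpotent. On \<open>[L, L]\<close>
  the action of \<open>Y\<close> is nilpotent because it is so on \<open>L / W\<close>, and the commutator of \<open>L\<close> factors
  through \<open>L / W\<close>.\<close>

section \<open>Commutators\<close>

text \<open>The subgroup \<open>[A, Y]\<close>. The acting set \<open>Y\<close> is the first set
  argument so that \<open>comm_with G Y\<close> can be iterated on \<open>A\<close>, which gives the
  series \<open>[A, Y, ..., Y]\<close>.\<close>

definition comm_with :: "('a, 'b) monoid_scheme \<Rightarrow> 'a set \<Rightarrow> 'a set \<Rightarrow> 'a set" where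
  "comm_with G Y A = generate G {commutator G a y | a y. a \<in> A \<and> y \<in> Y}"

context group
begin

lemma inv_mult_cancel:
  "\<lbrakk>a \<in> carrier G; b \<in> carrier G\<rbrakk> \<Longrightarrow> inv a \<otimes> (a \<otimes> b) = b"
  "\<lbrakk>a \<in> carrier G; b \<in> carrier G\<rbrakk> \<Longrightarrow> a \<otimes> (inv a \<otimes> b) = b"
  by (simp_all add: m_assoc[symmetric])

lemmas group_word_simps = commutator_def m_assoc inv_mult_group inv_mult_cancel

lemma commutator_closed [simp]:
  "\<lbrakk>x \<in> carrier G; y \<in> carrier G\<rbrakk> \<Longrightarrow> commutator G x y \<in> carrier G"
  by (simp add: commutator_def)

lemma commutator_eq_one_iff:
  assumes "x \<in> carrier G" "y \<in> carrier G"
  shows "commutator G x y = \<one> \<longleftrightarrow> x \<otimes> y = y \<otimes> x"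
proof -
  have "commutator G x y = (x \<otimes> y) \<otimes> inv (y \<otimes> x)"
    using assms by (simp add: commutator_def inv_mult_group m_assoc)
  then show ?thesis using assms by (metis inv_solve_right' l_one m_closed one_closed)
qed

lemma commutator_conj:
  assumes "x \<in> carrier G" "a \<in> carrier G" "b \<in> carrier G"
  shows "x \<otimes> commutator G a b \<otimes> inv x = commutator G (x \<otimes> a \<otimes> inv x) (x \<otimes> b \<otimes> inv x)"
  using assms by (simp add: group_word_simps)

lemma commuting_conj:
  assumes "x \<in> carrier G" "y \<in> carrier G" "x \<otimes> y = y \<otimes> x"
  shows "x \<otimes> y \<otimes> inv x = y"
  using assms by (simp add: m_assoc)

lemma subgroup_centralizer:
  assumes "y \<in> carrier G"
  shows "subgroup {x \<in> carrier G. x \<otimes> y = y \<otimes> x} G"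
proof (rule subgroupI)
  show "{x \<in> carrier G. x \<otimes> y = y \<otimes> x} \<noteq> {}" using assms by (auto intro: exI[of _ \<one>])
next
  fix a assume "a \<in> {x \<in> carrier G. x \<otimes> y = y \<otimes> x}"
  then have a: "a \<in> carrier G" "a \<otimes> y = y \<otimes> a" by auto
  have "inv a \<otimes> (a \<otimes> y) \<otimes> inv a = inv a \<otimes> (y \<otimes> a) \<otimes> inv a" using a(2) by simp
  then have "inv a \<otimes> y = y \<otimes> inv a"
    using a(1) assms by (simp add: m_assoc inv_mult_cancel)
  then show "inv a \<in> {x \<in> carrier G. x \<otimes> y = y \<otimes> x}" using a by auto
next
  fix a b assume "a \<in> {x \<in> carrier G. x \<otimes> y = y \<otimes> x}" "b \<in> {x \<in> carrier G. x \<otimes> y = y \<otimes> x}"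
  then have a: "a \<in> carrier G" "a \<otimes> y = y \<otimes> a" and b: "b \<in> carrier G" "b \<otimes> y = y \<otimes> b" by auto
  then have "a \<otimes> b \<otimes> y = y \<otimes> (a \<otimes> b)" using assms by (metis m_assoc)
  then show "a \<otimes> b \<in> {x \<in> carrier G. x \<otimes> y = y \<otimes> x}" using a b by auto
qed auto

text \<open>The Engel condition on the product \<open>g \<otimes> h\<close> serves to linearize it.
  Since \<open>g\<close> commutes with \<open>v\<close>, \<open>[g h, v]\<close> is the conjugate by
  \<open>g\<close> of \<open>w = [h, v]\<close>; cancelling \<open>g\<close> in the condition leaves
  \<open>h (g w g^-1) = w h = h w\<close>, so \<open>g\<close> centralizes \<open>w\<close>.\<close>

lemma commute_commutator_of_Engel:
  assumes c: "g \<in> carrier G" "h \<in> carrier G" "v \<in> carrier G"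
    and gv: "g \<otimes> v = v \<otimes> g"
    and h: "h \<otimes> commutator G h v = commutator G h v \<otimes> h"
    and gh: "(g \<otimes> h) \<otimes> commutator G (g \<otimes> h) v = commutator G (g \<otimes> h) v \<otimes> (g \<otimes> h)"
  shows "g \<otimes> commutator G h v = commutator G h v \<otimes> g"
proof -
  define w where "w = commutator G h v"
  have w: "w \<in> carrier G" using c by (simp add: w_def)
  have "inv g \<otimes> inv v = inv v \<otimes> inv g"
    using gv c by (metis inv_mult_group)
  then have "commutator G (g \<otimes> h) v = g \<otimes> w \<otimes> inv g"
    using c by (simp add: group_word_simps w_def)
  then have "g \<otimes> (h \<otimes> (g \<otimes> w \<otimes> inv g)) = g \<otimes> (w \<otimes> h)"
    using gh c w by (simp add: group_word_simps)
  then have "h \<otimes> (g \<otimes> w \<otimes> inv g) = h \<otimes> w"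
    using h c w by (simp add: w_def[symmetric])
  then have "g \<otimes> w \<otimes> inv g = w" using c w by simp
  then show ?thesis using c w unfolding w_def[symmetric] by (metis inv_solve_right' m_closed)
qed

section \<open>Subgroups generated by commutators\<close>

lemma generate_subset_iff:
  assumes "S \<subseteq> carrier G" "subgroup K G"
  shows "generate G S \<subseteq> K \<longleftrightarrow> S \<subseteq> K"
  using assms generate_subgroup_incl generate.incl by (metis subset_iff)

lemma commutator_set_carrier:
  "\<lbrakk>A \<subseteq> carrier G; Y \<subseteq> carrier G\<rbrakk> \<Longrightarrow> {commutator G a y | a y. a \<in> A \<and> y \<in> Y} \<subseteq> carrier G"
  by (auto simp: subset_iff)

lemma comm_with_mono:
  "\<lbrakk>A \<subseteq> B; Y \<subseteq> Z; B \<subseteq> carrier G; Z \<subseteq> carrier G\<rbrakk> \<Longrightarrow> comm_with G Y A \<subseteq> comm_with G Z B"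
  unfolding comm_with_def by (rule mono_generate) auto

lemma comm_with_subset_iff:
  assumes "A \<subseteq> carrier G" "Y \<subseteq> carrier G" "subgroup K G"
  shows "comm_with G Y A \<subseteq> K \<longleftrightarrow> (\<forall>a\<in>A. \<forall>y\<in>Y. commutator G a y \<in> K)"
  unfolding comm_with_def
  using generate_subset_iff[OF commutator_set_carrier[OF assms(1,2)] assms(3)] by auto

lemma comm_with_carrier:
  "\<lbrakk>A \<subseteq> carrier G; Y \<subseteq> carrier G\<rbrakk> \<Longrightarrow> comm_with G Y A \<subseteq> carrier G"
  unfolding comm_with_def by (intro generate_incl commutator_set_carrier)

lemma normal_comm_with:
  assumes "A \<lhd> G" "Y \<lhd> G"
  shows "comm_with G Y A \<lhd> G"
  unfolding comm_with_def
proof (rule normal_generateI)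
  have "A \<subseteq> carrier G" "Y \<subseteq> carrier G"
    using assms by (auto dest: normal_imp_subgroup subgroup.subset)
  then show "{commutator G a y | a y. a \<in> A \<and> y \<in> Y} \<subseteq> carrier G"
    by (auto simp: subset_iff)
  fix s x assume "s \<in> {commutator G a y | a y. a \<in> A \<and> y \<in> Y}" and x: "x \<in> carrier G"
  then obtain a y where s: "s = commutator G a y" "a \<in> A" "y \<in> Y" by auto
  then have "x \<otimes> s \<otimes> inv x = commutator G (x \<otimes> a \<otimes> inv x) (x \<otimes> y \<otimes> inv x)"
    using x \<open>A \<subseteq> carrier G\<close> \<open>Y \<subseteq> carrier G\<close> by (auto intro: commutator_conj)
  moreover have "x \<otimes> a \<otimes> inv x \<in> A" "x \<otimes> y \<otimes> inv x \<in> Y"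
    using s x assms by (auto simp: normal_inv_iff)
  ultimately show "x \<otimes> s \<otimes> inv x \<in> {commutator G a y | a y. a \<in> A \<and> y \<in> Y}" by blast
qed

lemma commutator_in_normal:
  assumes "N \<lhd> G" "y \<in> carrier G" "x \<in> N"
  shows "commutator G x y \<in> N" "commutator G y x \<in> N"
proof -
  have N: "subgroup N G" "N \<subseteq> carrier G"
    using assms by (auto dest: normal_imp_subgroup subgroup.subset)
  have "y \<otimes> inv x \<otimes> inv y \<in> N" "y \<otimes> x \<otimes> inv y \<in> N"
    using assms N by (auto simp: normal_inv_iff subgroup.m_inv_closed)
  then have "x \<otimes> (y \<otimes> inv x \<otimes> inv y) \<in> N" "(y \<otimes> x \<otimes> inv y) \<otimes> inv x \<in> N"
    using assms N by (auto intro: subgroup.m_closed subgroup.m_inv_closed)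
  then show "commutator G x y \<in> N" "commutator G y x \<in> N"
    using assms N by (auto simp: commutator_def m_assoc subset_iff)
qed

lemma comm_with_normal_subset:
  assumes "A \<lhd> G" "Y \<subseteq> carrier G"
  shows "comm_with G Y A \<subseteq> A"
  using assms normal_imp_subgroup[OF assms(1)]
  by (subst comm_with_subset_iff) (auto dest: subgroup.subset commutator_in_normal)

lemma comm_with_subset_normal:
  assumes "Y \<lhd> G" "A \<subseteq> carrier G"
  shows "comm_with G Y A \<subseteq> Y"
proof -
  have "Y \<subseteq> carrier G" using assms by (auto dest: normal_imp_subgroup subgroup.subset)
  then show ?thesis using assms normal_imp_subgroup[OF assms(1)]
    by (subst comm_with_subset_iff) (auto dest: commutator_in_normal)
qed

section \<open>Nilpotent actions\<close>

text \<open>The target \<open>B\<close> is arbitrary rather than trivial, so that actions on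
  successive stages of a series can be chained by \<open>nilpotent_action_trans\<close>.\<close>

definition nilpotent_action :: "'a set \<Rightarrow> 'a set \<Rightarrow> 'a set \<Rightarrow> bool" where
  "nilpotent_action Y A B \<longleftrightarrow> (\<exists>n. (comm_with G Y ^^ n) A \<subseteq> B)"

lemma iterate_comm_with_carrier:
  "\<lbrakk>A \<subseteq> carrier G; Y \<subseteq> carrier G\<rbrakk> \<Longrightarrow> (comm_with G Y ^^ n) A \<subseteq> carrier G"
  by (induction n) (auto simp: comm_with_carrier)

lemma iterate_comm_with_mono:
  "\<lbrakk>A \<subseteq> B; Y \<subseteq> Z; B \<subseteq> carrier G; Z \<subseteq> carrier G\<rbrakk>
    \<Longrightarrow> (comm_with G Y ^^ n) A \<subseteq> (comm_with G Z ^^ n) B"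
  by (induction n) (auto simp: comm_with_mono iterate_comm_with_carrier)

lemma normal_iterate_comm_with:
  "\<lbrakk>A \<lhd> G; Y \<lhd> G\<rbrakk> \<Longrightarrow> (comm_with G Y ^^ n) A \<lhd> G"
  by (induction n) (auto simp: normal_comm_with)

lemma nilpotent_action_subset: "A \<subseteq> B \<Longrightarrow> nilpotent_action Y A B"
  unfolding nilpotent_action_def by (intro exI[of _ 0]) auto

lemma nilpotent_action_step: "comm_with G Y A \<subseteq> B \<Longrightarrow> nilpotent_action Y A B"
  unfolding nilpotent_action_def by (intro exI[of _ 1]) auto

lemma nilpotent_action_mono:
  assumes "nilpotent_action Z A B" "Y \<subseteq> Z" "Z \<subseteq> carrier G" "A \<subseteq> carrier G"
  shows "nilpotent_action Y A B"
  using assms iterate_comm_with_mono[of A A Y Z] unfolding nilpotent_action_def by blast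

lemma nilpotent_action_trans:
  assumes "nilpotent_action Y A B" "nilpotent_action Y B C" "Y \<subseteq> carrier G" "B \<subseteq> carrier G"
  shows "nilpotent_action Y A C"
proof -
  obtain m n where mn: "(comm_with G Y ^^ m) A \<subseteq> B" "(comm_with G Y ^^ n) B \<subseteq> C"
    using assms unfolding nilpotent_action_def by blast
  have "(comm_with G Y ^^ (n + m)) A \<subseteq> (comm_with G Y ^^ n) B"
    using iterate_comm_with_mono[OF mn(1) subset_refl assms(4,3)] by (simp add: funpow_add)
  then show ?thesis using mn unfolding nilpotent_action_def by blast
qed

lemma commutator_in_subgroup:
  "\<lbrakk>subgroup H G; x \<in> H; y \<in> H\<rbrakk> \<Longrightarrow> commutator G x y \<in> H"
  by (simp add: commutator_def subgroup.m_closed subgroup.m_inv_closed)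

text \<open>Nilpotency of a subgroup refers to its own group structure. This moves its lower central
  series into the ambient group, where normal subgroups and homomorphisms of the ambient group
  apply.\<close>

lemma lower_central_subgroup:
  assumes "subgroup H G"
  shows "lower_central (G\<lparr>carrier := H\<rparr>) n = (comm_with G H ^^ n) H"
proof (induction n)
  case (Suc n)
  let ?A = "(comm_with G H ^^ n) H"
  have H: "H \<subseteq> carrier G" using assms by (rule subgroup.subset)
  have A: "?A \<subseteq> H"
  proof (induction n)
    case (Suc n)
    then have "comm_with G H ((comm_with G H ^^ n) H) \<subseteq> H"
      using comm_with_subset_iff[OF order_trans[OF Suc H] H assms]
        commutator_in_subgroup[OF assms] by (metis subsetD)
    then show ?case by simp
  qed auto
  have eq: "commutator (G\<lparr>carrier := H\<rparr>) x y = commutator G x y" if "x \<in> H" "y \<in> H" for x y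
    using that assms by (simp add: commutator_def)
  have "{commutator (G\<lparr>carrier := H\<rparr>) x y | x y. x \<in> ?A \<and> y \<in> H}
      = {commutator G x y | x y. x \<in> ?A \<and> y \<in> H}"
    using A eq by (metis (no_types, lifting) subsetD)
  moreover have "{commutator G x y | x y. x \<in> ?A \<and> y \<in> H} \<subseteq> H"
  proof clarify
    fix x y assume "x \<in> ?A" "y \<in> H"
    with A show "commutator G x y \<in> H" by (metis assms commutator_in_subgroup subsetD)
  qed
  ultimately show ?case
    using Suc.IH generate_consistent[OF _ assms] by (simp add: comm_with_def[of G H ?A])
qed auto

end

lemma (in group_hom) hom_commutator:
  "\<lbrakk>x \<in> carrier G; y \<in> carrier G\<rbrakk> \<Longrightarrow> h (commutator G x y) = commutator H (h x) (h y)"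
  by (simp add: commutator_def)

lemma (in group_hom) image_comm_with:
  assumes "A \<subseteq> carrier G" "Y \<subseteq> carrier G"
  shows "h ` comm_with G Y A = comm_with H (h ` Y) (h ` A)"
proof -
  have "h ` {commutator G a y | a y. a \<in> A \<and> y \<in> Y}
      = {commutator H a y | a y. a \<in> h ` A \<and> y \<in> h ` Y}" (is "_ ` ?S = ?T")
  proof
    show "h ` ?S \<subseteq> ?T" using assms hom_commutator by blast
    show "?T \<subseteq> h ` ?S"
    proof
      fix t assume "t \<in> ?T"
      then obtain a y where "t = commutator H (h a) (h y)" "a \<in> A" "y \<in> Y" by blast
      then have "t = h (commutator G a y)" using assms hom_commutator by (auto simp: subset_iff)
      then show "t \<in> h ` ?S" using \<open>a \<in> A\<close> \<open>y \<in> Y\<close> by blast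
    qed
  qed
  then show ?thesis
    unfolding comm_with_def using generate_img[OF G.commutator_set_carrier[OF assms]] by simp
qed

lemma (in group_hom) image_iterate_comm_with:
  assumes "A \<subseteq> carrier G" "Y \<subseteq> carrier G"
  shows "h ` (comm_with G Y ^^ n) A = (comm_with H (h ` Y) ^^ n) (h ` A)"
  using assms by (induction n) (auto simp: image_comm_with G.iterate_comm_with_carrier)


section \<open>Commuting modulo a normal subgroup\<close>

context group
begin

lemma hom_Mod:
  assumes "N \<lhd> G"
  shows "group_hom G (G Mod N) (\<lambda>x. N #> x)"
  using assms normal.r_coset_hom_Mod normal.factorgroup_is_group is_group
  by (auto simp: group_hom_def group_hom_axioms_def)

text \<open>The bridge to quotients: an implication between commutation relations, proved in an
  arbitrary group, is applied in \<open>G Mod N\<close> and read back as membership of commutators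
  in \<open>N\<close>.\<close>

lemma commutator_in_normal_iff:
  assumes "N \<lhd> G" "x \<in> carrier G" "y \<in> carrier G"
  shows "commutator G x y \<in> N \<longleftrightarrow>
    (N #> x) \<otimes>\<^bsub>G Mod N\<^esub> (N #> y) = (N #> y) \<otimes>\<^bsub>G Mod N\<^esub> (N #> x)"
proof -
  interpret q: group_hom G "G Mod N" "\<lambda>x. N #> x" by (rule hom_Mod[OF assms(1)])
  have "commutator G x y \<in> N \<longleftrightarrow> N #> commutator G x y = \<one>\<^bsub>G Mod N\<^esub>"
    using assms rcos_self[of "commutator G x y" N] coset_join2[of "commutator G x y" N]
    by (auto simp: one_FactGroup dest: normal_imp_subgroup)
  also have "\<dots> \<longleftrightarrow> commutator (G Mod N) (N #> x) (N #> y) = \<one>\<^bsub>G Mod N\<^esub>"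
    using q.hom_commutator assms by simp
  also have "\<dots> \<longleftrightarrow> (N #> x) \<otimes>\<^bsub>G Mod N\<^esub> (N #> y) = (N #> y) \<otimes>\<^bsub>G Mod N\<^esub> (N #> x)"
    using assms by (intro q.H.commutator_eq_one_iff q.hom_closed)
  finally show ?thesis .
qed

lemma commutator_in_normal_sym:
  assumes "N \<lhd> G" "x \<in> carrier G" "y \<in> carrier G"
  shows "commutator G x y \<in> N \<longleftrightarrow> commutator G y x \<in> N"
  using assms by (auto simp: commutator_in_normal_iff)

text \<open>This is the preimage of a centralizer in \<open>G Mod N\<close>. It reduces commutation
  modulo \<open>N\<close> to a check on generators.\<close>

lemma subgroup_centralizer_mod:
  assumes "N \<lhd> G" "y \<in> carrier G"
  shows "subgroup {x \<in> carrier G. commutator G x y \<in> N} G"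
proof -
  interpret q: group_hom G "G Mod N" "\<lambda>x. N #> x" by (rule hom_Mod[OF assms(1)])
  let ?C = "{x \<in> carrier (G Mod N). x \<otimes>\<^bsub>G Mod N\<^esub> (N #> y) = (N #> y) \<otimes>\<^bsub>G Mod N\<^esub> x}"
  have C: "subgroup ?C (G Mod N)" using assms by (intro q.H.subgroup_centralizer q.hom_closed)
  have eq: "{x \<in> carrier G. commutator G x y \<in> N} = {x \<in> carrier G. N #> x \<in> ?C}"
    using assms by (auto simp: commutator_in_normal_iff)
  show ?thesis unfolding eq
  proof (rule subgroupI)
    have "\<one> \<in> {x \<in> carrier G. N #> x \<in> ?C}"
      using subgroup.one_closed[OF C] q.hom_one by (auto simp del: q.hom_one)
    then show "{x \<in> carrier G. N #> x \<in> ?C} \<noteq> {}" by blast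
  next
    fix a assume "a \<in> {x \<in> carrier G. N #> x \<in> ?C}"
    then have "a \<in> carrier G" "N #> a \<in> ?C" by blast+
    then show "inv a \<in> {x \<in> carrier G. N #> x \<in> ?C}"
      using subgroup.m_inv_closed[OF C, of "N #> a"] q.hom_inv[of a] by auto
  next
    fix a b assume "a \<in> {x \<in> carrier G. N #> x \<in> ?C}" "b \<in> {x \<in> carrier G. N #> x \<in> ?C}"
    then have "a \<in> carrier G" "N #> a \<in> ?C" "b \<in> carrier G" "N #> b \<in> ?C" by blast+
    then show "a \<otimes> b \<in> {x \<in> carrier G. N #> x \<in> ?C}"
      using subgroup.m_closed[OF C, of "N #> a" "N #> b"] q.hom_mult[of a b] by auto
  qed auto
qed

lemma commute_commutator_of_Engel_mod:
  assumes N: "N \<lhd> G" and c: "g \<in> carrier G" "h \<in> carrier G" "v \<in> carrier G"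
    and gv: "commutator G g v \<in> N"
    and h: "commutator G h (commutator G h v) \<in> N"
    and gh: "commutator G (g \<otimes> h) (commutator G (g \<otimes> h) v) \<in> N"
  shows "commutator G g (commutator G h v) \<in> N"
proof -
  interpret q: group_hom G "G Mod N" "\<lambda>x. N #> x" by (rule hom_Mod[OF N])
  show ?thesis
    using q.H.commute_commutator_of_Engel[of "N #> g" "N #> h" "N #> v"] c gv h gh
    by (simp add: commutator_in_normal_iff[OF N] q.hom_commutator)
qed

text \<open>The centralizer of \<open>f\<close> in \<open>A/N\<close> is normal by \<open>commute_commutator_of_Engel_mod\<close>, and the Engel condition
  puts \<open>[A, f]\<close> into it; so it cuts \<open>A/N\<close> into two sections on which \<open>f\<close> acts trivially.\<close>

lemma Engel_nilpotent_action:
  assumes "finite F" "F \<subseteq> carrier G" "Z \<subseteq> carrier G" "generate G (F \<union> Z) = carrier G"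
    and "A \<lhd> G" "N \<lhd> G" "N \<subseteq> A"
    and "\<And>g v. \<lbrakk>g \<in> carrier G; v \<in> A\<rbrakk> \<Longrightarrow> commutator G g (commutator G g v) \<in> N"
    and "\<And>z v. \<lbrakk>z \<in> Z; v \<in> A\<rbrakk> \<Longrightarrow> commutator G z v \<in> N"
  shows "nilpotent_action (carrier G) A N"
  using assms
\<comment> \<open>\<open>A\<close>, \<open>N\<close> and \<open>Z\<close> vary because
  \<open>f\<close> moves from \<open>F\<close> into \<open>Z\<close>, the elements that act
  trivially, and the hypothesis is applied to both \<open>A / A1\<close> and \<open>A1 / N\<close>.
  Once \<open>F\<close> is empty, \<open>Z\<close> generates the whole group, which then acts
  trivially.\<close>
proof (induction F arbitrary: A N Z rule: finite_induct)
  case empty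
  have A: "A \<subseteq> carrier G" using empty.prems(4) by (rule subgroup.subset[OF normal_imp_subgroup])
  have "commutator G a y \<in> N" if "a \<in> A" "y \<in> carrier G" for a y
  proof -
    have a: "a \<in> carrier G" using that A by blast
    have "generate G Z \<subseteq> {x \<in> carrier G. commutator G x a \<in> N}"
      using empty.prems a that
      by (intro generate_subgroup_incl subgroup_centralizer_mod) auto
    then have "commutator G y a \<in> N" using that empty.prems by auto
    then show ?thesis using commutator_in_normal_sym a that empty.prems by blast
  qed
  then show ?case
    using A empty.prems
    by (intro nilpotent_action_step) (simp add: comm_with_subset_iff normal_imp_subgroup)
next
  case (insert f F)
  note Engel = insert.prems(7) and Z = insert.prems(8)
  have N: "N \<lhd> G" and A: "A \<subseteq> carrier G" "subgroup A G"
    using insert.prems(4,5) subgroup.subset[OF normal_imp_subgroup] normal_imp_subgroup by blast+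
  have f: "f \<in> carrier G" using insert.prems by auto
  define A1 where "A1 = A \<inter> {x \<in> carrier G. commutator G x f \<in> N}"
  have mem: "v \<in> A1 \<longleftrightarrow> v \<in> A \<and> commutator G f v \<in> N" for v
    using A f commutator_in_normal_sym[OF N] by (auto simp: A1_def)
  have sub: "subgroup A1 G"
    unfolding A1_def by (intro subgroups_Inter_pair A subgroup_centralizer_mod N f)
  have A1: "A1 \<lhd> G"
  proof (rule normal_invI[OF sub])
    fix x v assume x: "x \<in> carrier G" and v: "v \<in> A1"
    then have vc: "v \<in> carrier G" "v \<in> A" "commutator G f v \<in> N" using A(1) mem by blast+
    have "commutator G f (commutator G x v) \<in> N"
      by (rule commute_commutator_of_Engel_mod[OF N f x vc(1) vc(3) Engel[OF x vc(2)]
            Engel[OF m_closed[OF f x] vc(2)]])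
    then have "commutator G x v \<in> A1"
      using commutator_in_normal(2)[OF insert.prems(4) x vc(2)] mem by blast
    then have "commutator G x v \<otimes> v \<in> A1" using v sub by (simp add: subgroup.m_closed)
    then show "x \<otimes> v \<otimes> inv x \<in> A1" using vc x by (simp add: commutator_def m_assoc)
  qed
  have NA1: "N \<subseteq> A1"
    using insert.prems(6) commutator_in_normal(2)[OF N f] mem by blast
  have F: "F \<subseteq> carrier G" and Z': "insert f Z \<subseteq> carrier G" using insert.prems(1,2) by auto
  have A1A: "A1 \<subseteq> A" by (auto simp: A1_def)
  have gen: "generate G (F \<union> insert f Z) = carrier G" using insert.prems(3) by simp
  have "nilpotent_action (carrier G) A A1"
  proof (rule insert.IH[OF F Z' gen insert.prems(4) A1 A1A])
    show "commutator G g (commutator G g v) \<in> A1" if "g \<in> carrier G" "v \<in> A" for g v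
      using Engel[OF that] NA1 by blast
    fix z v assume "z \<in> insert f Z" "v \<in> A"
    moreover from this have "commutator G f v \<in> A"
      using commutator_in_normal(2)[OF insert.prems(4) f] by blast
    ultimately show "commutator G z v \<in> A1"
      using Engel[OF f, of v] Z[of z v] NA1 mem[of "commutator G f v"] by blast
  qed
  moreover have "nilpotent_action (carrier G) A1 N"
  proof (rule insert.IH[OF F Z' gen A1 N NA1])
    show "commutator G g (commutator G g v) \<in> N" if "g \<in> carrier G" "v \<in> A1" for g v
      using Engel[OF that(1)] that(2) mem by blast
    show "commutator G z v \<in> N" if "z \<in> insert f Z" "v \<in> A1" for z v
      using Z that mem by blast
  qed
  ultimately show ?case
    using subgroup.subset[OF sub] by (rule nilpotent_action_trans[OF _ _ subset_refl])
qed

section \<open>The action on commutators inside a normal subgroup\<close>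

text \<open>Conjugation by \<open>y\<close> sends \<open>a\<close> to \<open>a' a\<close> and
  \<open>b\<close> to \<open>b' b\<close>. The first three relations in \<open>e\<close> allow
  \<open>a'\<close> and \<open>b'\<close> to be pulled out of \<open>[a' a, b' b]\<close> as
  conjugating factors; by the last two these centralize \<open>[a, b]\<close>.\<close>

lemma commute_commutator:
  assumes c: "y \<in> carrier G" "a \<in> carrier G" "b \<in> carrier G"
    and a': "a' = commutator G y a" and b': "b' = commutator G y b"
    and e: "a' \<otimes> b = b \<otimes> a'" "a' \<otimes> b' = b' \<otimes> a'" "b' \<otimes> a = a \<otimes> b'"
      "a' \<otimes> commutator G a b = commutator G a b \<otimes> a'"
      "b' \<otimes> commutator G a b = commutator G a b \<otimes> b'"
  shows "y \<otimes> commutator G a b = commutator G a b \<otimes> y"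
proof -
  have a'c: "a' \<in> carrier G" and b'c: "b' \<in> carrier G" using a' b' c by auto
  have sw: "inv b' \<otimes> inv a' = inv a' \<otimes> inv b'" using e(2) a'c b'c by (metis inv_mult_group)
  have 1: "commutator G (a' \<otimes> a) b = a' \<otimes> commutator G a b \<otimes> inv a'"
  proof -
    have "inv b \<otimes> inv a' = inv a' \<otimes> inv b" using e(1) a'c c by (metis inv_mult_group)
    then show ?thesis using a'c c by (simp add: group_word_simps)
  qed
  have "commutator G (a' \<otimes> a) (b' \<otimes> b) = b' \<otimes> commutator G (a' \<otimes> a) b \<otimes> inv b'"
  proof -
    have "(a' \<otimes> a) \<otimes> b' = b' \<otimes> (a' \<otimes> a)" using e(2,3) a'c b'c c by (metis m_assoc)
    then have "a' \<otimes> (a \<otimes> (b' \<otimes> (b \<otimes> t))) = b' \<otimes> (a' \<otimes> (a \<otimes> (b \<otimes> t)))" if "t \<in> carrier G" for t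
      using a'c b'c c that by (metis m_assoc m_closed)
    then show ?thesis using a'c b'c c by (simp add: group_word_simps)
  qed
  also have "\<dots> = commutator G a b"
    unfolding 1 using commuting_conj[OF _ _ e(4)] commuting_conj[OF _ _ e(5)] a'c b'c c by simp
  finally have *: "commutator G (a' \<otimes> a) (b' \<otimes> b) = commutator G a b" .
  have "y \<otimes> commutator G a b \<otimes> inv y = commutator G (y \<otimes> a \<otimes> inv y) (y \<otimes> b \<otimes> inv y)"
    by (rule commutator_conj[OF c])
  also have "\<dots> = commutator G (a' \<otimes> a) (b' \<otimes> b)"
    using c by (simp add: a' b' group_word_simps)
  also have "\<dots> = commutator G a b" by (rule *)
  finally have "y \<otimes> commutator G a b \<otimes> inv y = commutator G a b" .
  then show ?thesis using c by (metis commutator_closed inv_solve_right' m_closed)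
qed

lemma commute_commutator_mod:
  assumes N: "N \<lhd> G" and c: "y \<in> carrier G" "a \<in> carrier G" "b \<in> carrier G"
    and a': "a' = commutator G y a" and b': "b' = commutator G y b"
    and e: "commutator G a' b \<in> N" "commutator G a' b' \<in> N" "commutator G b' a \<in> N"
      "commutator G a' (commutator G a b) \<in> N" "commutator G b' (commutator G a b) \<in> N"
  shows "commutator G y (commutator G a b) \<in> N"
proof -
  interpret q: group_hom G "G Mod N" "\<lambda>x. N #> x" by (rule hom_Mod[OF N])
  have "a' \<in> carrier G" "b' \<in> carrier G" using a' b' c by auto
  then show ?thesis
    using q.H.commute_commutator[of "N #> y" "N #> a" "N #> b" "N #> a'" "N #> b'"] c e
    by (simp add: commutator_in_normal_iff[OF N] q.hom_commutator a' b')
qed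

text \<open>With \<open>L\<^sub>i\<close> the iterated commutators of \<open>L\<close> with \<open>Y\<close>, the action of \<open>Y\<close> moves the subgroup
  generated by the \<open>[L\<^sub>i, L\<^sub>j]\<close> with \<open>i + j \<ge> k\<close> into the one for \<open>k + 1\<close>.\<close>

lemma nilpotent_action_comm_with:
  assumes L: "L \<lhd> G" and Y: "Y \<lhd> G" and W: "W \<subseteq> carrier G" "nilpotent_action Y L W"
    and central: "\<And>w a. \<lbrakk>w \<in> W; a \<in> L\<rbrakk> \<Longrightarrow> commutator G w a = \<one>"
  shows "nilpotent_action Y (comm_with G L L) {\<one>}"
proof -
  define M where "M i = (comm_with G Y ^^ i) L" for i
  \<comment> \<open>The weight bound is \<open>k \<le> i + j\<close> rather than an equality, so
    that commutators of higher weight, such as \<open>[[y, a], [y, b]]\<close>, are members at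
    once.\<close>
  define S where "S k = {commutator G a b | a b i j. a \<in> M i \<and> b \<in> M j \<and> k \<le> i + j}" for k
  have Yc: "Y \<subseteq> carrier G" and Lc: "L \<subseteq> carrier G"
    using Y L by (auto dest: normal_imp_subgroup subgroup.subset)
  have M: "M i \<lhd> G" for i unfolding M_def by (rule normal_iterate_comm_with[OF L Y])
  have Mc: "a \<in> carrier G" if "a \<in> M i" for a i
    using M[of i] that by (auto dest: normal_imp_subgroup subgroup.subset)
  have M_Suc: "commutator G y a \<in> M (Suc i)" if "y \<in> Y" "a \<in> M i" for y a i
  proof -
    have "commutator G a y \<in> M (Suc i)"
      using that unfolding M_def funpow.simps o_apply comm_with_def by (intro generate.incl) blast
    then show ?thesis
      using commutator_in_normal_sym[OF M] that Mc Yc by blast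
  qed
  have M_anti: "M (i + k) \<subseteq> M i" for i k
  proof (induction k)
    case (Suc k)
    have "M (i + Suc k) \<subseteq> M (i + k)"
      using comm_with_normal_subset[OF M Yc, of "i + k"] by (simp add: M_def)
    then show ?case using Suc by blast
  qed simp
  have SI: "commutator G a b \<in> S k" if "a \<in> M i" "b \<in> M j" "k \<le> i + j" for a b i j k
    unfolding S_def using that by blast
  have S: "S k \<subseteq> carrier G" for k unfolding S_def using Mc by (auto intro: commutator_closed)
  have N: "generate G (S k) \<lhd> G" for k
  proof (rule normal_generateI[OF S])
    fix s x assume "s \<in> S k" and x: "x \<in> carrier G"
    then obtain a b i j where s: "s = commutator G a b" "a \<in> M i" "b \<in> M j" "k \<le> i + j"
      unfolding S_def by blast
    have "x \<otimes> a \<otimes> inv x \<in> M i" "x \<otimes> b \<otimes> inv x \<in> M j"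
      using M s x normal_inv_iff by blast+
    then have "commutator G (x \<otimes> a \<otimes> inv x) (x \<otimes> b \<otimes> inv x) \<in> S k" using s(4) by (rule SI)
    then show "x \<otimes> s \<otimes> inv x \<in> S k"
      using commutator_conj[OF x Mc[OF s(2)] Mc[OF s(3)]] s(1) by simp
  qed
  have step: "comm_with G Y (generate G (S k)) \<subseteq> generate G (S (Suc k))" for k
  proof -
    let ?N = "generate G (S (Suc k))"
    have "commutator G x y \<in> ?N" if x: "x \<in> generate G (S k)" and y: "y \<in> Y" for x y
    proof -
      have yc: "y \<in> carrier G" using y Yc by blast
      have "generate G (S k) \<subseteq> {x \<in> carrier G. commutator G x y \<in> ?N}"
      proof (rule generate_subgroup_incl[OF _ subgroup_centralizer_mod[OF N yc]], rule subsetI)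
        fix s assume "s \<in> S k"
        then obtain a b i j where s: "s = commutator G a b"
          and a: "a \<in> M i" and b: "b \<in> M j" and k: "k \<le> i + j"
          unfolding S_def by blast
        \<comment> \<open>Against \<open>[y, a]\<close> the element \<open>[a, b]\<close> is counted
          in \<open>M j\<close>, against \<open>[y, b]\<close> in \<open>M i\<close>; either way the
          weight is \<open>i + j + 1\<close>.\<close>
        have ab: "commutator G a b \<in> M i" "commutator G a b \<in> M j"
          using commutator_in_normal(1)[OF M Mc[OF b] a] commutator_in_normal(2)[OF M Mc[OF a] b]
          by auto
        have "commutator G y s \<in> ?N" unfolding s
        proof (rule commute_commutator_mod[OF N yc Mc[OF a] Mc[OF b] refl refl])
          show "commutator G (commutator G y a) b \<in> ?N"
            using k by (intro generate.incl SI[OF M_Suc[OF y a] b]) simp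
          show "commutator G (commutator G y a) (commutator G y b) \<in> ?N"
            using k by (intro generate.incl SI[OF M_Suc[OF y a] M_Suc[OF y b]]) simp
          show "commutator G (commutator G y b) a \<in> ?N"
            using k by (intro generate.incl SI[OF M_Suc[OF y b] a]) simp
          show "commutator G (commutator G y a) (commutator G a b) \<in> ?N"
            using k by (intro generate.incl SI[OF M_Suc[OF y a] ab(2)]) simp
          show "commutator G (commutator G y b) (commutator G a b) \<in> ?N"
            using k by (intro generate.incl SI[OF M_Suc[OF y b] ab(1)]) simp
        qed
        then show "s \<in> {x \<in> carrier G. commutator G x y \<in> ?N}"
          using commutator_in_normal_sym[OF N _ yc] s a b Mc by auto
      qed
      then show ?thesis using x by blast
    qed
    then show ?thesis
      using normal_imp_subgroup[OF N] generate_incl[OF S] Yc by (simp add: comm_with_subset_iff)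
  qed
  have "comm_with G L L \<subseteq> generate G (S 0)"
    unfolding comm_with_def
  proof (intro mono_generate subsetI)
    fix s assume "s \<in> {commutator G a y | a y. a \<in> L \<and> y \<in> L}"
    then show "s \<in> S 0" using SI[of _ 0 _ 0 0] by (auto simp: M_def)
  qed
  then have iter: "(comm_with G Y ^^ k) (comm_with G L L) \<subseteq> generate G (S k)" for k
  proof (induction k)
    case (Suc k)
    have "comm_with G Y ((comm_with G Y ^^ k) (comm_with G L L)) \<subseteq> comm_with G Y (generate G (S k))"
      using Suc Yc generate_incl[OF S] by (intro comm_with_mono) auto
    then show ?case using step[of k] by simp
  qed simp
  obtain c where "M c \<subseteq> W" using W unfolding nilpotent_action_def M_def by blast
  then have W: "M i \<subseteq> W" if "c \<le> i" for i
    using M_anti[of c "i - c"] that by auto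
  have L: "M i \<subseteq> L" for i using M_anti[of 0 i] by (simp add: M_def)
  \<comment> \<open>If \<open>i + j\<close> is at least \<open>2 * c\<close>, one of the indices is
    at least \<open>c\<close>, so one entry of the commutator lies in \<open>W\<close> and commutes
    with the other, which lies in \<open>L\<close>.\<close>
  have "S (2 * c) \<subseteq> {\<one>}"
  proof
    fix s assume "s \<in> S (2 * c)"
    then obtain a b i j where s: "s = commutator G a b" "a \<in> M i" "b \<in> M j" "2 * c \<le> i + j"
      unfolding S_def by blast
    then have "c \<le> i \<or> c \<le> j" by linarith
    then have "a \<in> W \<and> b \<in> L \<or> b \<in> W \<and> a \<in> L" using W L s by blast
    moreover have "commutator G b a = \<one> \<longleftrightarrow> commutator G a b = \<one>"
      using s Mc by (auto simp: commutator_eq_one_iff)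
    ultimately show "s \<in> {\<one>}" using central s by auto
  qed
  then have "generate G (S (2 * c)) \<subseteq> {\<one>}" by (intro generate_subgroup_incl triv_subgroup)
  then show ?thesis using iter unfolding nilpotent_action_def by blast
qed

end


section \<open>Finite index\<close>

context group
begin

text \<open>The values of \<open>c\<close> are colours, and the colour of an element determines its
  coset; so there are at most as many cosets as colours.\<close>

lemma finite_rcosetsI:
  assumes H: "subgroup H G" and T: "finite T" "\<And>x. x \<in> carrier G \<Longrightarrow> c x \<in> T"
    and c: "\<And>x y. \<lbrakk>x \<in> carrier G; y \<in> carrier G; c x = c y\<rbrakk> \<Longrightarrow> x \<otimes> inv y \<in> H"
  shows "finite (rcosets H)"
proof (rule finite_subset)
  show "rcosets H \<subseteq> (\<lambda>t. H #> (SOME x. x \<in> carrier G \<and> c x = t)) ` T"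
  proof
    fix C assume "C \<in> rcosets H"
    then obtain x where x: "x \<in> carrier G" "C = H #> x" by (auto simp: RCOSETS_def)
    define y where "y = (SOME y. y \<in> carrier G \<and> c y = c x)"
    have y: "y \<in> carrier G" "c y = c x"
      using someI[of "\<lambda>y. y \<in> carrier G \<and> c y = c x" x] x by (auto simp: y_def)
    then have "x \<in> H #> y"
      using c[of x y] x H is_group by (simp add: subgroup.rcos_module)
    then have "C = H #> y" using repr_independence[OF _ y(1) H] x by simp
    then show "C \<in> (\<lambda>t. H #> (SOME x. x \<in> carrier G \<and> c x = t)) ` T"
      using T(2)[OF x(1)] unfolding y_def by blast
  qed
qed (use T in simp)

text \<open>The core, the intersection of all conjugates of \<open>H\<close>, is the kernel of the
  action on the right cosets of \<open>H\<close> by right translation. The colour of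
  \<open>x\<close> is the map it induces on these cosets, written as an extensional function so that
  there are finitely many.\<close>

lemma normal_core:
  assumes H: "subgroup H G" and fin: "finite (rcosets H)"
  obtains N where "N \<lhd> G" "N \<subseteq> H" "finite (rcosets N)"
proof
  let ?N = "{n \<in> carrier G. \<forall>x\<in>carrier G. x \<otimes> n \<otimes> inv x \<in> H}"
  have sub: "subgroup ?N G"
  proof (rule subgroupI)
    have "\<one> \<in> ?N" using H by (simp add: subgroup.one_closed)
    then show "?N \<noteq> {}" by blast
  next
    fix a assume a: "a \<in> ?N"
    have "x \<otimes> inv a \<otimes> inv x = inv (x \<otimes> a \<otimes> inv x)" if "x \<in> carrier G" for x
      using that a by (simp add: inv_mult_group m_assoc)
    then show "inv a \<in> ?N" using a H by (simp add: subgroup.m_inv_closed)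
  next
    fix a b assume ab: "a \<in> ?N" "b \<in> ?N"
    have "x \<otimes> (a \<otimes> b) \<otimes> inv x = (x \<otimes> a \<otimes> inv x) \<otimes> (x \<otimes> b \<otimes> inv x)" if "x \<in> carrier G" for x
      using that ab by (simp add: m_assoc inv_mult_cancel)
    then show "a \<otimes> b \<in> ?N" using ab H by (simp add: subgroup.m_closed)
  qed auto
  show "?N \<lhd> G"
  proof (rule normal_invI[OF sub])
    fix x n assume x: "x \<in> carrier G" and n: "n \<in> ?N"
    have "y \<otimes> (x \<otimes> n \<otimes> inv x) \<otimes> inv y = (y \<otimes> x) \<otimes> n \<otimes> inv (y \<otimes> x)" if "y \<in> carrier G" for y
      using that x n by (simp add: m_assoc inv_mult_group)
    then show "x \<otimes> n \<otimes> inv x \<in> ?N" using x n by simp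
  qed
  show "?N \<subseteq> H"
  proof
    fix n assume "n \<in> ?N"
    then have "n \<in> carrier G" "\<one> \<otimes> n \<otimes> inv \<one> \<in> H" by blast+
    then show "n \<in> H" by simp
  qed
  have Hc: "H \<subseteq> carrier G" using H by (rule subgroup.subset)
  show "finite (rcosets ?N)"
  proof (rule finite_rcosetsI[OF sub])
    show "finite (rcosets H \<rightarrow>\<^sub>E rcosets H)" using fin by (simp add: finite_PiE)
    show "(\<lambda>C\<in>rcosets H. C #> x) \<in> rcosets H \<rightarrow>\<^sub>E rcosets H" if "x \<in> carrier G" for x
      using that Hc by (auto simp: RCOSETS_def coset_mult_assoc)
    fix x y assume xy: "x \<in> carrier G" "y \<in> carrier G"
      "(\<lambda>C\<in>rcosets H. C #> x) = (\<lambda>C\<in>rcosets H. C #> y)"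
    have "z \<otimes> (x \<otimes> inv y) \<otimes> inv z \<in> H" if z: "z \<in> carrier G" for z
    proof -
      have "H #> z \<in> rcosets H" using z Hc by (simp add: rcosetsI)
      then have "H #> z #> x = H #> z #> y" using xy(3) by (metis restrict_apply')
      then have "H #> (z \<otimes> x) = H #> (z \<otimes> y)" using xy z Hc by (simp add: coset_mult_assoc)
      then have "z \<otimes> x \<in> H #> (z \<otimes> y)" using rcos_self[OF _ H, of "z \<otimes> x"] xy z by simp
      then have "(z \<otimes> x) \<otimes> inv (z \<otimes> y) \<in> H"
        using xy z H is_group by (simp add: subgroup.rcos_module)
      then show ?thesis using xy z by (simp add: inv_mult_group m_assoc)
    qed
    then show "x \<otimes> inv y \<in> ?N" using xy by simp
  qed
qed

section \<open>Normality and the Engel condition from generators\<close>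

text \<open>Conjugation by one \<open>s\<close> is followed through the words in \<open>T\<close>; a
  word in \<open>S\<close> then conjugates letter by letter. Closure of \<open>S\<close> under
  inverses is asked for because \<open>s K s^-1 \<subseteq> K\<close> alone says nothing about
  \<open>inv s\<close>.\<close>

lemma normal_generate_of_generators:
  assumes S: "S \<subseteq> carrier G" "generate G S = carrier G" "\<And>s. s \<in> S \<Longrightarrow> inv s \<in> S"
    and T: "T \<subseteq> carrier G" "\<And>s t. \<lbrakk>s \<in> S; t \<in> T\<rbrakk> \<Longrightarrow> s \<otimes> t \<otimes> inv s \<in> generate G T"
  shows "generate G T \<lhd> G"
proof (rule normal_invI)
  let ?K = "generate G T"
  show K: "subgroup ?K G" using T(1) by (rule generate_is_subgroup)
  have Kc: "k \<in> carrier G" if "k \<in> ?K" for k using that generate_in_carrier[OF T(1)] by blast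
  have SK: "s \<otimes> k \<otimes> inv s \<in> ?K" if s: "s \<in> S" and k: "k \<in> ?K" for s k
    using k
  proof induction
    case one
    show ?case using s S(1) generate.one by (auto simp: subset_iff)
  next
    case (incl t)
    show ?case by (rule T(2)[OF s incl])
  next
    case (inv t)
    have "inv (s \<otimes> t \<otimes> inv s) = s \<otimes> inv t \<otimes> inv s"
      using s S(1) inv T(1) by (simp add: inv_mult_group m_assoc subset_iff)
    then show ?case using subgroup.m_inv_closed[OF K T(2)[OF s inv]] by simp
  next
    case (eng a b)
    have "(s \<otimes> a \<otimes> inv s) \<otimes> (s \<otimes> b \<otimes> inv s) = s \<otimes> (a \<otimes> b) \<otimes> inv s"
      using s S(1) Kc[OF eng(1)] Kc[OF eng(2)] by (simp add: m_assoc inv_mult_cancel subset_iff)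
    then show ?case using subgroup.m_closed[OF K eng(3,4)] by simp
  qed
  fix x k assume "x \<in> carrier G" and k: "k \<in> ?K"
  then have "x \<in> generate G S" using S(2) by simp
  then show "x \<otimes> k \<otimes> inv x \<in> ?K" using k
  proof (induction arbitrary: k)
    case one
    then show ?case using Kc by simp
  next
    case (eng x y)
    have "x \<otimes> (y \<otimes> k \<otimes> inv y) \<otimes> inv x = (x \<otimes> y) \<otimes> k \<otimes> inv (x \<otimes> y)"
      using generate_in_carrier[OF S(1)] eng Kc by (simp add: m_assoc inv_mult_group)
    then show ?case using eng by metis
  qed (use SK S(3) in auto)
qed

text \<open>Since \<open>u\<close> commutes with \<open>[g, v]\<close>, the commutator
  \<open>[g, u v]\<close> is just \<open>[g, u] [g, v]\<close>, a product of elements centralizing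
  \<open>g\<close>. With \<open>Engel_inv\<close> this spreads the condition from generators over an
  abelian normal subgroup.\<close>

lemma Engel_mult:
  assumes "g \<in> carrier G" "u \<in> carrier G" "v \<in> carrier G"
    and "commutator G g v \<otimes> u = u \<otimes> commutator G g v"
    and "g \<otimes> commutator G g u = commutator G g u \<otimes> g"
    and "g \<otimes> commutator G g v = commutator G g v \<otimes> g"
  shows "g \<otimes> commutator G g (u \<otimes> v) = commutator G g (u \<otimes> v) \<otimes> g"
proof -
  have "commutator G g (u \<otimes> v) = commutator G g u \<otimes> (u \<otimes> commutator G g v \<otimes> inv u)"
    using assms(1-3) by (simp add: group_word_simps)
  also have "u \<otimes> commutator G g v \<otimes> inv u = commutator G g v"
    using assms(1-4) by (simp add: commuting_conj)
  finally show ?thesis using assms by (metis commutator_closed m_assoc)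
qed

lemma Engel_inv:
  assumes "g \<in> carrier G" "u \<in> carrier G"
    and "commutator G g u \<otimes> u = u \<otimes> commutator G g u"
    and "g \<otimes> commutator G g u = commutator G g u \<otimes> g"
  shows "g \<otimes> commutator G g (inv u) = commutator G g (inv u) \<otimes> g"
proof -
  let ?c = "commutator G g u"
  have c: "?c \<in> carrier G" using assms by simp
  have "commutator G g (inv u) = inv u \<otimes> inv ?c \<otimes> u"
    using assms(1,2) by (simp add: group_word_simps)
  also have "\<dots> = inv (inv u \<otimes> ?c \<otimes> u)"
    using c assms(2) by (simp add: inv_mult_group m_assoc)
  also have "inv u \<otimes> ?c \<otimes> u = ?c"
    using c assms(2,3) by (simp add: m_assoc inv_mult_cancel)
  finally have "commutator G g (inv u) = inv ?c" .
  moreover have "inv ?c \<otimes> g = g \<otimes> inv ?c"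
    using subgroup.m_inv_closed[OF subgroup_centralizer[OF assms(1)], of ?c] assms c by simp
  ultimately show ?thesis by simp
qed

text \<open>As \<open>l\<close> centralizes both \<open>v\<close> and \<open>[g, v]\<close>, one has
  \<open>[l g, v] = [g, v]\<close>. This changes the acting element within its coset modulo an
  abelian normal subgroup.\<close>

lemma Engel_translate:
  assumes "l \<in> carrier G" "g \<in> carrier G" "v \<in> carrier G"
    and "l \<otimes> v = v \<otimes> l"
    and "l \<otimes> commutator G g v = commutator G g v \<otimes> l"
    and "g \<otimes> commutator G g v = commutator G g v \<otimes> g"
  shows "(l \<otimes> g) \<otimes> commutator G (l \<otimes> g) v = commutator G (l \<otimes> g) v \<otimes> (l \<otimes> g)"
proof -
  have "commutator G (l \<otimes> g) v = (l \<otimes> commutator G g v \<otimes> inv l) \<otimes> commutator G l v"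
    using assms(1-3) by (simp add: group_word_simps)
  also have "l \<otimes> commutator G g v \<otimes> inv l = commutator G g v"
    using commuting_conj[OF _ _ assms(5)] assms(1-3) by simp
  also have "commutator G l v = \<one>"
    using assms by (simp add: commutator_eq_one_iff)
  finally have "commutator G (l \<otimes> g) v = commutator G g v"
    using assms by simp
  then show ?thesis using assms by (metis commutator_closed m_assoc)
qed

end

lemma hom_eq_on_generate:
  assumes "group_hom G H h" "group_hom G H k" "S \<subseteq> carrier G"
    and "\<And>s. s \<in> S \<Longrightarrow> h s = k s" "x \<in> generate G S"
  shows "h x = k x"
proof -
  interpret h: group_hom G H h by fact
  interpret k: group_hom G H k by fact
  show ?thesis using assms(5)
  proof induction
    case (inv s)
    then show ?case using assms(3,4) by (simp add: subset_iff)
  next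
    case (eng a b)
    then show ?case using h.G.generate_in_carrier[OF assms(3)] by simp
  qed (use assms(4) in auto)
qed


section \<open>Groups generated by two weakly commuting copies\<close>

text \<open>These are the properties of \<open>weak_comm_group G\<close> on which the argument
  rests, stated abstractly so that words and cosets stay out of it. The three retractions stand in
  for the universal property.\<close>

locale weakly_commuting_copies = X: group X + G: group G
  for X (structure) and G :: "('a, 'b) monoid_scheme" +
  fixes f f' p q r
  assumes f: "f \<in> hom G X" and f': "f' \<in> hom G X"
    and generators: "generate X (f ` carrier G \<union> f' ` carrier G) = carrier X"
    and weak_comm: "g \<in> carrier G \<Longrightarrow> f g \<otimes> f' g = f' g \<otimes> f g"
    and p: "p \<in> hom X G" and q: "q \<in> hom X G" and r: "r \<in> hom X G"
    and p_f: "g \<in> carrier G \<Longrightarrow> p (f g) = g" and p_f': "g \<in> carrier G \<Longrightarrow> p (f' g) = \<one>\<^bsub>G\<^esub>"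
    and q_f: "g \<in> carrier G \<Longrightarrow> q (f g) = g" and q_f': "g \<in> carrier G \<Longrightarrow> q (f' g) = g"
    and r_f: "g \<in> carrier G \<Longrightarrow> r (f g) = \<one>\<^bsub>G\<^esub>" and r_f': "g \<in> carrier G \<Longrightarrow> r (f' g) = g"
begin

sublocale f: group_hom G X f
  using f by (simp add: group_hom_def group_hom_axioms_def)
sublocale f': group_hom G X f'
  using f' by (simp add: group_hom_def group_hom_axioms_def)
sublocale p: group_hom X G p
  using p by (simp add: group_hom_def group_hom_axioms_def)
sublocale q: group_hom X G q
  using q by (simp add: group_hom_def group_hom_axioms_def)
sublocale r: group_hom X G r
  using r by (simp add: group_hom_def group_hom_axioms_def)

section \<open>The kernel \<open>L\<close> of the common retraction\<close>

definition ell :: "'a \<Rightarrow> 'c" where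
  "ell k = f' k \<otimes> inv (f k)"

definition L :: "'c set" where
  "L = generate X (ell ` carrier G)"

definition D :: "'c set" where
  "D = generate X {commutator X (f g) (f' h) | g h. g \<in> carrier G \<and> h \<in> carrier G}"

text \<open>The kernel of \<open>(p, q, r)\<close> into \<open>G\<^sup>3\<close>: in this form
  membership can be tested on three images. That it lies in \<open>L \<inter> D\<close> is shown in
  \<open>W_subset_L\<close> and \<open>W_subset_D\<close>.\<close>

definition W :: "'c set" where
  "W = {x \<in> carrier X. p x = \<one>\<^bsub>G\<^esub> \<and> q x = \<one>\<^bsub>G\<^esub> \<and> r x = \<one>\<^bsub>G\<^esub>}"

lemma generators_closed: "f ` carrier G \<union> f' ` carrier G \<subseteq> carrier X"
  by auto

lemma generators_inv:
  "s \<in> f ` carrier G \<union> f' ` carrier G \<Longrightarrow> inv s \<in> f ` carrier G \<union> f' ` carrier G"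
  by (auto simp: f.hom_inv[symmetric] f'.hom_inv[symmetric] simp del: f.hom_inv f'.hom_inv)

lemma ell_closed [simp]: "k \<in> carrier G \<Longrightarrow> ell k \<in> carrier X"
  by (simp add: ell_def)

lemma ell_in_L: "k \<in> carrier G \<Longrightarrow> ell k \<in> L"
  unfolding L_def by (intro generate.incl imageI)

lemma ells_closed: "ell ` carrier G \<subseteq> carrier X"
  by auto

lemma subgroup_L: "subgroup L X"
  unfolding L_def by (rule X.generate_is_subgroup[OF ells_closed])

lemma f'_eq: "k \<in> carrier G \<Longrightarrow> f' k = ell k \<otimes> f k"
  by (simp add: ell_def X.m_assoc)

lemma ell_commute: "k \<in> carrier G \<Longrightarrow> f k \<otimes> ell k = ell k \<otimes> f k"
  by (simp add: ell_def X.m_assoc[symmetric] weak_comm)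
    (simp add: X.m_assoc)

text \<open>So \<open>ell\<close> is a crossed homomorphism for the conjugation action through
  \<open>f\<close>, the multiplicative form of \<open>k h - 1 = (k - 1) + k (h - 1)\<close> in the
  augmentation ideal.\<close>

lemma ell_mult:
  assumes "k \<in> carrier G" "h \<in> carrier G"
  shows "ell (k \<otimes>\<^bsub>G\<^esub> h) = ell k \<otimes> (f k \<otimes> ell h \<otimes> inv (f k))"
  using assms by (simp add: ell_def X.inv_mult_group X.m_assoc X.inv_mult_cancel)

lemma ell_conj:
  assumes "g \<in> carrier G" "k \<in> carrier G"
  shows "f g \<otimes> ell k \<otimes> inv (f g) = inv (ell g) \<otimes> ell (g \<otimes>\<^bsub>G\<^esub> k)"
  using assms by (simp add: ell_mult X.m_assoc X.inv_mult_cancel)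

text \<open>By \<open>ell_conj\<close>, conjugation by \<open>f g\<close> sends generators into
  \<open>L\<close>; conjugation by \<open>f' g = ell g \<otimes> f g\<close> differs from it only by
  conjugation with an element of \<open>L\<close>.\<close>

lemma normal_L: "L \<lhd> X"
  unfolding L_def
proof (rule X.normal_generate_of_generators[OF generators_closed generators generators_inv ells_closed])
  fix s t assume s: "s \<in> f ` carrier G \<union> f' ` carrier G" and "t \<in> ell ` carrier G"
  then obtain k where k: "k \<in> carrier G" "t = ell k" by blast
  have f_conj: "f g \<otimes> ell k \<otimes> inv (f g) \<in> L" if "g \<in> carrier G" for g
    unfolding ell_conj[OF that k(1)]
    using that k by (intro subgroup.m_closed[OF subgroup_L] subgroup.m_inv_closed[OF subgroup_L] ell_in_L) auto
  from s show "s \<otimes> t \<otimes> inv s \<in> generate X (ell ` carrier G)"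
    unfolding L_def[symmetric]
  proof
    assume "s \<in> f' ` carrier G"
    then obtain g where g: "g \<in> carrier G" "s = f' g" by blast
    have "s \<otimes> t \<otimes> inv s = ell g \<otimes> (f g \<otimes> ell k \<otimes> inv (f g)) \<otimes> inv (ell g)"
      using g k by (simp add: f'_eq X.inv_mult_group X.m_assoc)
    then show "s \<otimes> t \<otimes> inv s \<in> L"
      using f_conj g subgroup_L by (simp add: ell_in_L subgroup.m_closed subgroup.m_inv_closed)
  qed (use f_conj k in blast)
qed

text \<open>Both sides are homomorphisms into \<open>X Mod L\<close> that agree on the two copies of
  \<open>G\<close>. Hence \<open>X = L f(G)\<close>, and the kernel of \<open>q\<close> is contained
  in \<open>L\<close>.\<close>

lemma coset_f_q:
  assumes "x \<in> carrier X"
  shows "L #> x = L #> f (q x)"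
proof -
  interpret M: group_hom X "X Mod L" "\<lambda>x. L #> x" by (rule X.hom_Mod[OF normal_L])
  have fq: "group_hom X (X Mod L) (\<lambda>x. L #> f (q x))"
    by unfold_locales (auto simp: hom_def)
  show ?thesis
  proof (rule hom_eq_on_generate[OF M.group_hom_axioms fq generators_closed])
    show "x \<in> generate X (f ` carrier G \<union> f' ` carrier G)" using assms generators by simp
    have "L #> f' g = L #> f g" if "g \<in> carrier G" for g
    proof -
      have "f' g \<in> L #> f g"
        using that by (simp add: f'_eq X.rcosI ell_in_L subgroup.subset[OF subgroup_L])
      then show ?thesis using X.repr_independence[OF _ _ subgroup_L] that by simp
    qed
    then show "L #> s = L #> f (q s)" if "s \<in> f ` carrier G \<union> f' ` carrier G" for s
      using that q_f q_f' by auto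
  qed
qed

lemma decompose:
  assumes "x \<in> carrier X"
  obtains l where "l \<in> L" "x = l \<otimes> f (q x)"
  using X.rcos_self[OF assms subgroup_L] unfolding coset_f_q[OF assms]
  by (auto simp: r_coset_def)

lemma W_subset_L: "W \<subseteq> L"
proof
  fix x assume "x \<in> W"
  then have x: "x \<in> carrier X" "q x = \<one>\<^bsub>G\<^esub>" by (auto simp: W_def)
  obtain l where "l \<in> L" "x = l \<otimes> f (q x)" by (rule decompose[OF x(1)])
  then show "x \<in> L" using x subgroup.subset[OF subgroup_L] by auto
qed

section \<open>The subgroup \<open>D\<close> of mixed commutators and its commutation with
  \<open>L\<close>\<close>

lemma D_generators_closed:
  "{commutator X (f g) (f' h) | g h. g \<in> carrier G \<and> h \<in> carrier G} \<subseteq> carrier X"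
  by auto

lemma subgroup_D: "subgroup D X"
  unfolding D_def by (rule X.generate_is_subgroup[OF D_generators_closed])

lemma commutator_in_D:
  "\<lbrakk>g \<in> carrier G; h \<in> carrier G\<rbrakk> \<Longrightarrow> commutator X (f g) (f' h) \<in> D"
  unfolding D_def by (rule generate.incl) blast

text \<open>The product rule for \<open>[f (k g), f' h]\<close>, solved for the conjugate:
  conjugation by the first copy keeps the generators of \<open>D\<close> in \<open>D\<close>. The
  next lemma does this for the second copy.\<close>

lemma f_conj_commutator:
  assumes "k \<in> carrier G" "g \<in> carrier G" "h \<in> carrier G"
  shows "f k \<otimes> commutator X (f g) (f' h) \<otimes> inv (f k)
    = commutator X (f (k \<otimes>\<^bsub>G\<^esub> g)) (f' h) \<otimes> inv (commutator X (f k) (f' h))"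
  using assms by (simp add: X.group_word_simps)

lemma f'_conj_commutator:
  assumes "k \<in> carrier G" "g \<in> carrier G" "h \<in> carrier G"
  shows "f' k \<otimes> commutator X (f g) (f' h) \<otimes> inv (f' k)
    = inv (commutator X (f g) (f' k)) \<otimes> commutator X (f g) (f' (k \<otimes>\<^bsub>G\<^esub> h))"
  using assms by (simp add: X.group_word_simps)

lemma normal_D: "D \<lhd> X"
  unfolding D_def
proof (rule X.normal_generate_of_generators[OF generators_closed generators generators_inv D_generators_closed])
  fix s t assume s: "s \<in> f ` carrier G \<union> f' ` carrier G"
    and "t \<in> {commutator X (f g) (f' h) | g h. g \<in> carrier G \<and> h \<in> carrier G}"
  then obtain g h where gh: "g \<in> carrier G" "h \<in> carrier G" "t = commutator X (f g) (f' h)" by blast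
  have "s \<otimes> t \<otimes> inv s \<in> D"
    using s
  proof
    assume "s \<in> f ` carrier G"
    then obtain k where k: "k \<in> carrier G" "s = f k" by blast
    show ?thesis unfolding gh(3) k(2) f_conj_commutator[OF k(1) gh(1,2)]
      using k gh by (intro subgroup.m_closed[OF subgroup_D] subgroup.m_inv_closed[OF subgroup_D]
          commutator_in_D) auto
  next
    assume "s \<in> f' ` carrier G"
    then obtain k where k: "k \<in> carrier G" "s = f' k" by blast
    show ?thesis unfolding gh(3) k(2) f'_conj_commutator[OF k(1) gh(1,2)]
      using k gh by (intro subgroup.m_closed[OF subgroup_D] subgroup.m_inv_closed[OF subgroup_D]
          commutator_in_D) auto
  qed
  then show "s \<otimes> t \<otimes> inv s
      \<in> generate X {commutator X (f g) (f' h) | g h. g \<in> carrier G \<and> h \<in> carrier G}"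
    by (simp add: D_def)
qed

text \<open>Modulo \<open>D\<close> the two copies commute elementwise, so the right-hand side is a
  homomorphism in \<open>x\<close>; it agrees with the quotient map on both copies.\<close>

lemma coset_f_p_f'_r:
  assumes "x \<in> carrier X"
  shows "D #> x = D #> (f (p x) \<otimes> f' (r x))"
proof -
  let ?M = "X Mod D"
  interpret M: group_hom X ?M "\<lambda>x. D #> x" by (rule X.hom_Mod[OF normal_D])
  have comm: "(D #> f g) \<otimes>\<^bsub>?M\<^esub> (D #> f' h) = (D #> f' h) \<otimes>\<^bsub>?M\<^esub> (D #> f g)"
    if "g \<in> carrier G" "h \<in> carrier G" for g h
    using that commutator_in_D X.commutator_in_normal_iff[OF normal_D] by simp
  have "(\<lambda>x. D #> (f (p x) \<otimes> f' (r x))) \<in> hom X ?M"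
  proof (rule homI)
    fix x y assume xy: "x \<in> carrier X" "y \<in> carrier X"
    let ?a = "D #> f (p x)" and ?b = "D #> f (p y)" and ?c = "D #> f' (r x)" and ?d = "D #> f' (r y)"
    have bcd: "?b \<in> carrier ?M" "?c \<in> carrier ?M" "?d \<in> carrier ?M" using xy by (auto intro: M.hom_closed)
    then have "?b \<otimes>\<^bsub>?M\<^esub> (?c \<otimes>\<^bsub>?M\<^esub> ?d) = ?c \<otimes>\<^bsub>?M\<^esub> (?b \<otimes>\<^bsub>?M\<^esub> ?d)"
      using comm[of "p y" "r x"] xy by (metis M.H.m_assoc p.hom_closed r.hom_closed)
    moreover have "?a \<in> carrier ?M" using xy by (auto intro: M.hom_closed)
    ultimately have "(?a \<otimes>\<^bsub>?M\<^esub> ?b) \<otimes>\<^bsub>?M\<^esub> (?c \<otimes>\<^bsub>?M\<^esub> ?d) = (?a \<otimes>\<^bsub>?M\<^esub> ?c) \<otimes>\<^bsub>?M\<^esub> (?b \<otimes>\<^bsub>?M\<^esub> ?d)"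
      using bcd by (simp add: M.H.m_assoc del: mult_FactGroup)
    then show "D #> (f (p (x \<otimes> y)) \<otimes> f' (r (x \<otimes> y)))
        = (D #> (f (p x) \<otimes> f' (r x))) \<otimes>\<^bsub>?M\<^esub> (D #> (f (p y) \<otimes> f' (r y)))"
      using xy by (simp del: mult_FactGroup)
  qed (simp del: M.hom_mult mult_FactGroup)
  then have *: "group_hom X ?M (\<lambda>x. D #> (f (p x) \<otimes> f' (r x)))"
    by (simp add: group_hom_def group_hom_axioms_def)
  show ?thesis
  proof (rule hom_eq_on_generate[OF M.group_hom_axioms * generators_closed])
    show "x \<in> generate X (f ` carrier G \<union> f' ` carrier G)" using assms generators by simp
    show "D #> s = D #> (f (p s) \<otimes> f' (r s))" if "s \<in> f ` carrier G \<union> f' ` carrier G" for s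
      using that p_f p_f' r_f r_f' by auto
  qed
qed

lemma W_subset_D: "W \<subseteq> D"
proof
  fix x assume "x \<in> W"
  then have x: "x \<in> carrier X" "p x = \<one>\<^bsub>G\<^esub>" "r x = \<one>\<^bsub>G\<^esub>" by (auto simp: W_def)
  have "x \<in> D #> \<one>"
    using X.rcos_self[OF x(1) subgroup_D] coset_f_p_f'_r[OF x(1)] x by simp
  then show "x \<in> D" using subgroup.subset[OF subgroup_D] by simp
qed

text \<open>This is the relation that \<open>f (g\<^sup>-\<^sup>1 h)\<close> commutes with \<open>f' (g\<^sup>-\<^sup>1 h)\<close>, rearranged.\<close>

lemma commutator_swap_bar:
  assumes g: "g \<in> carrier G" and h: "h \<in> carrier G"
  shows "commutator X (f g) (f' h) = commutator X (f' g) (f h)"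
proof -
  define a where "a = f (inv\<^bsub>G\<^esub> g)"
  define a' where "a' = f' (inv\<^bsub>G\<^esub> g)"
  define b where "b = f h"
  define b' where "b' = f' h"
  have c: "a \<in> carrier X" "a' \<in> carrier X" "b \<in> carrier X" "b' \<in> carrier X"
    using g h by (auto simp: a_def a'_def b_def b'_def)
  have aa: "a \<otimes> a' = a' \<otimes> a" and bb: "b \<otimes> b' = b' \<otimes> b"
    using weak_comm g h by (auto simp: a_def a'_def b_def b'_def simp del: f.hom_inv f'.hom_inv)
  have "(a \<otimes> b) \<otimes> (a' \<otimes> b') = (a' \<otimes> b') \<otimes> (a \<otimes> b)"
    using weak_comm[of "inv\<^bsub>G\<^esub> g \<otimes>\<^bsub>G\<^esub> h"] g h
    by (simp add: a_def a'_def b_def b'_def del: f.hom_inv f'.hom_inv)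
  \<comment> \<open>Here \<open>inv a\<close> is \<open>f g\<close> and \<open>inv a'\<close> is
    \<open>f' g\<close>. After this multiplication on both sides, the relations \<open>aa\<close>
    and \<open>bb\<close> reduce the left side to \<open>[f' g, f h]\<close> and the right side to
    \<open>[f g, f' h]\<close>.\<close>
  then have "inv a' \<otimes> (inv a \<otimes> ((a \<otimes> b) \<otimes> (a' \<otimes> b')) \<otimes> inv b) \<otimes> inv b'
      = inv a' \<otimes> (inv a \<otimes> ((a' \<otimes> b') \<otimes> (a \<otimes> b)) \<otimes> inv b) \<otimes> inv b'" by simp
  moreover have "inv a' \<otimes> (inv a \<otimes> ((a \<otimes> b) \<otimes> (a' \<otimes> b')) \<otimes> inv b) \<otimes> inv b'
      = inv a' \<otimes> (b \<otimes> (a' \<otimes> inv b))"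
  proof -
    have "b' \<otimes> (inv b \<otimes> inv b') = inv b"
      using bb c by (metis X.inv_closed X.inv_mult_group X.inv_mult_cancel(2))
    then show ?thesis using c by (simp add: X.m_assoc X.inv_mult_cancel)
  qed
  moreover have "inv a' \<otimes> (inv a \<otimes> ((a' \<otimes> b') \<otimes> (a \<otimes> b)) \<otimes> inv b) \<otimes> inv b'
      = inv a \<otimes> (b' \<otimes> (a \<otimes> inv b'))"
  proof -
    have "inv a' \<otimes> (inv a \<otimes> (a' \<otimes> t)) = inv a \<otimes> t" if "t \<in> carrier X" for t
    proof -
      have "inv a' \<otimes> inv a = inv a \<otimes> inv a'" using aa c by (metis X.inv_mult_group)
      then show ?thesis using c that by (metis X.inv_closed X.inv_mult_cancel(1) X.m_assoc X.m_closed)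
    qed
    then show ?thesis using c by (simp add: X.m_assoc X.inv_mult_cancel)
  qed
  ultimately have "inv a \<otimes> (b' \<otimes> (a \<otimes> inv b')) = inv a' \<otimes> (b \<otimes> (a' \<otimes> inv b))" by simp
  then show ?thesis
    using g h by (simp add: a_def a'_def b_def b'_def commutator_def X.m_assoc)
qed

text \<open>Written with commutators, the conjugate of \<open>[f g, f' h]\<close> by
  \<open>f k\<close> becomes the conjugate by \<open>f' k\<close> when the bar is swapped in each of
  them. So \<open>inv (f k) \<otimes> f' k\<close> centralizes \<open>[f g, f' h]\<close>, and by
  weak commutation this element is \<open>ell k\<close>.\<close>

lemma ell_commute_commutator:
  assumes k: "k \<in> carrier G" and g: "g \<in> carrier G" and h: "h \<in> carrier G"
  shows "ell k \<otimes> commutator X (f g) (f' h) = commutator X (f g) (f' h) \<otimes> ell k"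
proof -
  let ?c = "commutator X (f g) (f' h)"
  have c: "?c \<in> carrier X" using g h by simp
  have "f k \<otimes> ?c \<otimes> inv (f k)
      = commutator X (f' (k \<otimes>\<^bsub>G\<^esub> g)) (f h) \<otimes> inv (commutator X (f' k) (f h))"
    using assms by (simp add: f_conj_commutator commutator_swap_bar[symmetric] del: f'.hom_mult)
  also have "\<dots> = f' k \<otimes> commutator X (f' g) (f h) \<otimes> inv (f' k)"
    using assms by (simp add: X.group_word_simps)
  also have "commutator X (f' g) (f h) = ?c" using assms by (simp add: commutator_swap_bar)
  finally have "f k \<otimes> ?c \<otimes> inv (f k) = f' k \<otimes> ?c \<otimes> inv (f' k)" .
  then have "inv (f k) \<otimes> (f k \<otimes> ?c \<otimes> inv (f k)) \<otimes> f' k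
      = inv (f k) \<otimes> (f' k \<otimes> ?c \<otimes> inv (f' k)) \<otimes> f' k" by simp
  then have "?c \<otimes> (inv (f k) \<otimes> f' k) = (inv (f k) \<otimes> f' k) \<otimes> ?c"
    using c k by (simp add: X.m_assoc X.inv_mult_cancel)
  moreover have "inv (f k) \<otimes> f' k = ell k"
    using k weak_comm[OF k] by (simp add: ell_def X.inv_solve_left' X.m_assoc[symmetric])
      (simp add: X.m_assoc)
  ultimately show ?thesis by simp
qed

lemma D_commute_L:
  assumes d: "d \<in> D" and l: "l \<in> L"
  shows "d \<otimes> l = l \<otimes> d"
proof -
  have dc: "d \<in> carrier X" using d subgroup.subset[OF subgroup_D] by blast
  have "d \<otimes> ell k = ell k \<otimes> d" if "k \<in> carrier G" for k
  proof -
    have "D \<subseteq> {x \<in> carrier X. x \<otimes> ell k = ell k \<otimes> x}"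
      unfolding D_def using that
      by (intro X.generate_subgroup_incl X.subgroup_centralizer)
        (auto simp: ell_commute_commutator)
    then show ?thesis using d by blast
  qed
  then have "L \<subseteq> {x \<in> carrier X. x \<otimes> d = d \<otimes> x}"
    unfolding L_def using dc
    by (intro X.generate_subgroup_incl X.subgroup_centralizer) auto
  then show ?thesis using l by auto
qed

section \<open>The Engel condition on \<open>L\<close> modulo \<open>[L, L]\<close>\<close>

lemma comm_with_L_subset_L: "comm_with X L L \<subseteq> L"
  by (rule X.comm_with_normal_subset[OF normal_L subgroup.subset[OF subgroup_L]])

lemma normal_comm_with_L: "comm_with X L L \<lhd> X"
  by (rule X.normal_comm_with[OF normal_L normal_L])

lemma commutator_in_comm_with_L: "\<lbrakk>a \<in> L; b \<in> L\<rbrakk> \<Longrightarrow> commutator X a b \<in> comm_with X L L"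
  unfolding comm_with_def by (rule generate.incl) blast

text \<open>With \<open>g' = k\<^sup>-\<^sup>1 g k\<close> one has \<open>ell (g k) = ell (k g') = ell k \<cdot> k (ell g') k\<^sup>-\<^sup>1\<close>; so modulo \<open>[L, L]\<close>
  the commutator of \<open>g\<close> with \<open>ell k\<close> is a product of two elements that commute with \<open>g\<close>.\<close>

lemma Engel_ell:
  assumes g: "g \<in> carrier G" and k: "k \<in> carrier G"
  shows "commutator X (f g) (commutator X (f g) (ell k)) \<in> comm_with X L L"
proof -
  let ?N = "comm_with X L L"
  interpret M: group_hom X "X Mod ?N" "\<lambda>x. ?N #> x" by (rule X.hom_Mod[OF normal_comm_with_L])
  define g' where "g' = inv\<^bsub>G\<^esub> k \<otimes>\<^bsub>G\<^esub> g \<otimes>\<^bsub>G\<^esub> k"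
  define t where "t = f k \<otimes> ell g' \<otimes> inv (f k)"
  have g': "g' \<in> carrier G" "g \<otimes>\<^bsub>G\<^esub> k = k \<otimes>\<^bsub>G\<^esub> g'"
    using g k by (simp_all add: g'_def G.m_assoc G.inv_mult_cancel)
  have tL: "t \<in> L" and tc: "t \<in> carrier X"
    using normal_L g' k ell_in_L unfolding t_def by (auto simp: X.normal_inv_iff)
  have fg: "f g = f k \<otimes> f g' \<otimes> inv (f k)"
    using g k by (simp add: g'_def X.m_assoc X.inv_mult_cancel)
  \<comment> \<open>\<open>f g\<close> and \<open>t\<close> are the conjugates by \<open>f k\<close>
    of \<open>f g'\<close> and \<open>ell g'\<close>, which commute by weak commutation.\<close>
  have ft: "f g \<otimes> t = t \<otimes> f g"
  proof -
    have "f g \<otimes> t = f k \<otimes> (f g' \<otimes> ell g') \<otimes> inv (f k)"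
      unfolding fg t_def using k g' by (simp add: X.m_assoc X.inv_mult_cancel)
    also have "\<dots> = f k \<otimes> (ell g' \<otimes> f g') \<otimes> inv (f k)" using g' by (simp add: ell_commute)
    also have "\<dots> = t \<otimes> f g"
      unfolding fg t_def using k g' by (simp add: X.m_assoc X.inv_mult_cancel)
    finally show ?thesis .
  qed
  have e: "commutator X (f g) (ell k) = inv (ell g) \<otimes> (ell k \<otimes> t \<otimes> inv (ell k))"
  proof -
    have "commutator X (f g) (ell k) = f g \<otimes> ell k \<otimes> inv (f g) \<otimes> inv (ell k)"
      by (simp add: commutator_def)
    also have "f g \<otimes> ell k \<otimes> inv (f g) = inv (ell g) \<otimes> ell (k \<otimes>\<^bsub>G\<^esub> g')"
      using g k g' by (simp add: ell_conj)
    finally show ?thesis using g k g' tc by (simp add: ell_mult t_def X.m_assoc)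
  qed
  have Mt: "?N #> (ell k \<otimes> t \<otimes> inv (ell k)) = ?N #> t"
  proof -
    have "(?N #> ell k) \<otimes>\<^bsub>X Mod ?N\<^esub> (?N #> t) = (?N #> t) \<otimes>\<^bsub>X Mod ?N\<^esub> (?N #> ell k)"
      using X.commutator_in_normal_iff[OF normal_comm_with_L, of "ell k" t]
        commutator_in_comm_with_L[OF ell_in_L[OF k] tL] tc k by (simp del: mult_FactGroup)
    then show ?thesis
      using M.H.commuting_conj[of "?N #> ell k" "?N #> t"] k tc by (simp del: mult_FactGroup)
  qed
  have "?N #> commutator X (f g) (ell k) = ?N #> (inv (ell g) \<otimes> t)"
    unfolding e using Mt tc g k by (simp del: mult_FactGroup)
  moreover have "f g \<otimes> (inv (ell g) \<otimes> t) = (inv (ell g) \<otimes> t) \<otimes> f g"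
  proof -
    have "ell g \<otimes> f g = f g \<otimes> ell g" using g by (simp add: ell_commute)
    then have "inv (ell g) \<otimes> f g = f g \<otimes> inv (ell g)"
      using subgroup.m_inv_closed[OF X.subgroup_centralizer[of "f g"], of "ell g"] g by simp
    then have "inv (ell g) \<otimes> t \<otimes> f g = f g \<otimes> (inv (ell g) \<otimes> t)"
      using subgroup.m_closed[OF X.subgroup_centralizer[of "f g"], of "inv (ell g)" t] ft tc g
      by simp
    then show ?thesis by simp
  qed
  then have "(?N #> f g) \<otimes>\<^bsub>X Mod ?N\<^esub> (?N #> (inv (ell g) \<otimes> t))
      = (?N #> (inv (ell g) \<otimes> t)) \<otimes>\<^bsub>X Mod ?N\<^esub> (?N #> f g)"
    using M.hom_mult[of "f g" "inv (ell g) \<otimes> t"] M.hom_mult[of "inv (ell g) \<otimes> t" "f g"] tc g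
    by (simp del: M.hom_mult mult_FactGroup)
  ultimately show ?thesis
    using g k by (simp add: X.commutator_in_normal_iff[OF normal_comm_with_L] del: M.hom_mult mult_FactGroup)
qed

text \<open>As \<open>L / [L, L]\<close> is abelian, the condition for a fixed \<open>f g0\<close>
  spreads from the generators \<open>ell k\<close> to all of \<open>L\<close>. Every element of
  \<open>X\<close> is some \<open>l \<otimes> f (q g)\<close> with \<open>l\<close> in
  \<open>L\<close>, and the factor \<open>l\<close> acts trivially.\<close>

lemma Engel_L:
  assumes g: "g \<in> carrier X" and v: "v \<in> L"
  shows "commutator X g (commutator X g v) \<in> comm_with X L L"
proof -
  let ?N = "comm_with X L L"
  let ?M = "X Mod ?N"
  interpret M: group_hom X ?M "\<lambda>x. ?N #> x" by (rule X.hom_Mod[OF normal_comm_with_L])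
  have Lc: "u \<in> carrier X" if "u \<in> L" for u using that subgroup.subset[OF subgroup_L] by blast
  have abelian: "(?N #> u) \<otimes>\<^bsub>?M\<^esub> (?N #> w) = (?N #> w) \<otimes>\<^bsub>?M\<^esub> (?N #> u)" if "u \<in> L" "w \<in> L" for u w
    using X.commutator_in_normal_iff[OF normal_comm_with_L Lc[OF that(1)] Lc[OF that(2)]]
      commutator_in_comm_with_L[OF that] by simp
  have comm_L: "commutator X y u \<in> L" if "y \<in> carrier X" "u \<in> L" for y u
    using X.commutator_in_normal(2)[OF normal_L that] .
  have iff: "commutator X y (commutator X y u) \<in> ?N \<longleftrightarrow>
      (?N #> y) \<otimes>\<^bsub>?M\<^esub> commutator ?M (?N #> y) (?N #> u)
        = commutator ?M (?N #> y) (?N #> u) \<otimes>\<^bsub>?M\<^esub> (?N #> y)"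
    if "y \<in> carrier X" "u \<in> carrier X" for y u
    using that by (simp add: X.commutator_in_normal_iff[OF normal_comm_with_L] M.hom_commutator
        del: mult_FactGroup)
  have comm_ab: "commutator ?M (?N #> y) (?N #> u) \<otimes>\<^bsub>?M\<^esub> (?N #> w)
      = (?N #> w) \<otimes>\<^bsub>?M\<^esub> commutator ?M (?N #> y) (?N #> u)"
    if "y \<in> carrier X" "u \<in> L" "w \<in> L" for y u w
    using abelian[OF comm_L[OF that(1,2)] that(3)] that Lc by (simp add: M.hom_commutator del: mult_FactGroup)
  have f_case: "commutator X (f g0) (commutator X (f g0) u) \<in> ?N" if g0: "g0 \<in> carrier G" and "u \<in> L" for g0 u
  proof -
    have "u \<in> generate X (ell ` carrier G)" using that(2) by (simp add: L_def)
    then show ?thesis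
    proof induction
      case one
      show ?case
        using X.commutator_eq_one_iff[of "f g0" \<one>] g0
          subgroup.one_closed[OF normal_imp_subgroup[OF normal_comm_with_L]] by simp
    next
      case (incl u)
      then show ?case using Engel_ell[OF g0] by auto
    next
      case (inv u)
      then have u: "u \<in> L" "commutator X (f g0) (commutator X (f g0) u) \<in> ?N"
        using Engel_ell[OF g0] ell_in_L by auto
      then show ?case
        using M.H.Engel_inv[of "?N #> f g0" "?N #> u"] comm_ab[of "f g0" u u] Lc[OF u(1)] g0
        by (simp add: iff del: mult_FactGroup)
    next
      case (eng u w)
      then have u: "u \<in> L" "w \<in> L" by (simp_all add: L_def)
      then show ?case
        using M.H.Engel_mult[of "?N #> f g0" "?N #> u" "?N #> w"] comm_ab[of "f g0" w u] eng.IH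
          Lc[OF u(1)] Lc[OF u(2)] g0
        by (simp add: iff del: mult_FactGroup)
    qed
  qed
  obtain l where l: "l \<in> L" "g = l \<otimes> f (q g)" by (rule decompose[OF g])
  let ?g = "f (q g)"
  have qg: "q g \<in> carrier G" "?g \<in> carrier X" using g by auto
  have "commutator X (l \<otimes> ?g) (commutator X (l \<otimes> ?g) v) \<in> ?N"
    using M.H.Engel_translate[of "?N #> l" "?N #> ?g" "?N #> v"] abelian[OF l(1) v]
      comm_ab[OF qg(2) v l(1)] f_case[OF qg(1) v] Lc[OF l(1)] Lc[OF v] qg
    by (simp add: iff del: mult_FactGroup)
  then show ?thesis using l(2) by simp
qed

lemma nilpotent_action_L:
  assumes "finite S" "S \<subseteq> carrier G" "generate G S = carrier G"
  shows "X.nilpotent_action (carrier X) L (comm_with X L L)"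
proof (rule X.Engel_nilpotent_action[where F = "f ` S" and Z = L])
  have Lc: "L \<subseteq> carrier X" by (rule subgroup.subset[OF subgroup_L])
  show "f ` S \<subseteq> carrier X" using assms by auto
  then have sub: "subgroup (generate X (f ` S \<union> L)) X"
    using Lc by (intro X.generate_is_subgroup) auto
  have fG: "f ` carrier G \<subseteq> generate X (f ` S \<union> L)"
    using f.generate_img[OF assms(2)] X.mono_generate[of "f ` S" "f ` S \<union> L"] assms(3) by auto
  have LL: "L \<subseteq> generate X (f ` S \<union> L)" by (auto intro: generate.incl)
  have "x \<in> generate X (f ` S \<union> L)" if x: "x \<in> carrier X" for x
  proof -
    obtain l where l: "l \<in> L" "x = l \<otimes> f (q x)" by (rule decompose[OF x])
    have "f (q x) \<in> f ` carrier G" using x by simp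
    then have "l \<otimes> f (q x) \<in> generate X (f ` S \<union> L)"
      using fG LL l(1) by (blast intro: subgroup.m_closed[OF sub])
    then show ?thesis using l(2) by simp
  qed
  then show "generate X (f ` S \<union> L) = carrier X"
    using subgroup.subset[OF sub] by blast
  show "finite (f ` S)" using assms(1) by simp
qed (use normal_L normal_comm_with_L comm_with_L_subset_L Engel_L commutator_in_comm_with_L
    subgroup.subset[OF subgroup_L] in simp_all)

section \<open>Virtual nilpotency of \<open>X\<close>\<close>

theorem virtually_nilpotent:
  assumes "finitely_generated_group G" "virtually_nilpotent_group G"
  shows "virtually_nilpotent_group X"
proof -
  obtain S where S: "finite S" "S \<subseteq> carrier G" "generate G S = carrier G"
    using assms unfolding finitely_generated_group_def by blast
  obtain H where H: "subgroup H G" "finite (rcosets\<^bsub>G\<^esub> H)" "nilpotent_group (G\<lparr>carrier := H\<rparr>)"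
    using assms unfolding virtually_nilpotent_group_def by blast
  obtain K where K: "K \<lhd> G" "K \<subseteq> H" "finite (rcosets\<^bsub>G\<^esub> K)"
    by (rule G.normal_core[OF H(1,2)])
  have subK: "subgroup K G" and Hc: "H \<subseteq> carrier G" and Kc: "K \<subseteq> carrier G"
    using K H by (auto dest: normal_imp_subgroup subgroup.subset)
  \<comment> \<open>The preimage of \<open>K \<times> K \<times> K\<close> in \<open>X\<close>. Its
    index is finite because the triple of cosets of \<open>p x\<close>, \<open>q x\<close>,
    \<open>r x\<close> determines the coset of \<open>x\<close>.\<close>
  define Y where "Y = {x \<in> carrier X. p x \<in> K \<and> q x \<in> K \<and> r x \<in> K}"
  have subY: "subgroup Y X"
  proof (rule X.subgroupI)
    have "\<one> \<in> Y" using subgroup.one_closed[OF subK] by (simp add: Y_def)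
    then show "Y \<noteq> {}" by blast
  qed (auto simp: Y_def subgroup.m_closed[OF subK] subgroup.m_inv_closed[OF subK])
  have Yc: "Y \<subseteq> carrier X" by (auto simp: Y_def)
  have Lc: "L \<subseteq> carrier X" by (rule subgroup.subset[OF subgroup_L])
  have Wc: "W \<subseteq> carrier X" by (auto simp: W_def)
  have normalY: "Y \<lhd> X"
    using K(1) by (intro X.normal_invI[OF subY]) (auto simp: Y_def G.normal_inv_iff)
  have "finite (rcosets Y)"
  proof (rule X.finite_rcosetsI[OF subY])
    let ?R = "rcosets\<^bsub>G\<^esub> K"
    show "finite (?R \<times> ?R \<times> ?R)" using K by simp
    show "(K #>\<^bsub>G\<^esub> p x, K #>\<^bsub>G\<^esub> q x, K #>\<^bsub>G\<^esub> r x) \<in> ?R \<times> ?R \<times> ?R" if "x \<in> carrier X" for x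
      using that Kc by (auto intro: G.rcosetsI)
    have coset: "a \<otimes>\<^bsub>G\<^esub> inv\<^bsub>G\<^esub> b \<in> K"
      if "K #>\<^bsub>G\<^esub> a = K #>\<^bsub>G\<^esub> b" "a \<in> carrier G" "b \<in> carrier G" for a b
      using that G.rcos_self[OF that(2) subK] subgroup.rcos_module[OF subK G.is_group that(3,2)] by simp
    show "x \<otimes> inv y \<in> Y" if "x \<in> carrier X" "y \<in> carrier X"
      "(K #>\<^bsub>G\<^esub> p x, K #>\<^bsub>G\<^esub> q x, K #>\<^bsub>G\<^esub> r x) = (K #>\<^bsub>G\<^esub> p y, K #>\<^bsub>G\<^esub> q y, K #>\<^bsub>G\<^esub> r y)" for x y
      using that coset by (simp add: Y_def)
  qed
  moreover have "nilpotent_group (X\<lparr>carrier := Y\<rparr>)"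
  proof -
    obtain n where n: "(comm_with G H ^^ n) H = {\<one>\<^bsub>G\<^esub>}"
      using H(3) G.lower_central_subgroup[OF H(1)] by (auto simp: nilpotent_group_def)
    \<comment> \<open>The number \<open>n\<close> belongs to \<open>H\<close>. Each retraction maps
      \<open>Y\<close> into \<open>K \<subseteq> H\<close>, so \<open>n\<close> commutators with
      \<open>Y\<close> push \<open>Y\<close> into all three kernels, that is, into
      \<open>W\<close>.\<close>
    have triv: "h ` (comm_with X Y ^^ n) Y \<subseteq> {\<one>\<^bsub>G\<^esub>}" if "group_hom X G h" "h ` Y \<subseteq> H" for h
    proof -
      interpret h: group_hom X G h by fact
      have "h ` (comm_with X Y ^^ n) Y = (comm_with G (h ` Y) ^^ n) (h ` Y)"
        by (rule h.image_iterate_comm_with[OF Yc Yc])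
      also have "\<dots> \<subseteq> (comm_with G H ^^ n) H"
        using that(2) Hc by (intro G.iterate_comm_with_mono) auto
      finally show ?thesis using n by simp
    qed
    have "(comm_with X Y ^^ n) Y \<subseteq> W"
      using triv[OF p.group_hom_axioms] triv[OF q.group_hom_axioms] triv[OF r.group_hom_axioms]
        X.iterate_comm_with_carrier[OF Yc Yc, of n] K(2)
      unfolding W_def Y_def by blast
    then have YW: "X.nilpotent_action Y Y W" unfolding X.nilpotent_action_def by blast
    \<comment> \<open>In general \<open>L\<close> is not contained in \<open>Y\<close>, since
      \<open>p (ell k)\<close> is the inverse of \<open>k\<close>; one commutator with the normal
      subgroup \<open>Y\<close> brings it there.\<close>
    have "X.nilpotent_action Y L Y"
      by (rule X.nilpotent_action_step[OF X.comm_with_subset_normal[OF normalY Lc]])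
    then have LW: "X.nilpotent_action Y L W" by (rule X.nilpotent_action_trans[OF _ YW Yc Yc])
    have "X.nilpotent_action Y (comm_with X L L) {\<one>}"
    proof (rule X.nilpotent_action_comm_with[OF normal_L normalY Wc LW])
      fix w a assume "w \<in> W" "a \<in> L"
      then show "commutator X w a = \<one>"
        using D_commute_L W_subset_D Wc Lc by (auto simp: X.commutator_eq_one_iff subset_iff)
    qed
    moreover have "X.nilpotent_action Y L (comm_with X L L)"
      by (rule X.nilpotent_action_mono[OF nilpotent_action_L[OF S] Yc subset_refl Lc])
    ultimately have "X.nilpotent_action Y L {\<one>}"
      using X.nilpotent_action_trans[OF _ _ Yc order_trans[OF comm_with_L_subset_L Lc]] by blast
    \<comment> \<open>The descent is now complete: from \<open>Y\<close> to
      \<open>W \<subseteq> L\<close>, from \<open>L\<close> to \<open>[L, L]\<close>, and from there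
      to the trivial group.\<close>
    then have "X.nilpotent_action Y W {\<one>}"
      by (rule X.nilpotent_action_trans[OF X.nilpotent_action_subset[OF W_subset_L] _ Yc Lc])
    then have "X.nilpotent_action Y Y {\<one>}"
      by (rule X.nilpotent_action_trans[OF YW _ Yc Wc])
    then obtain m where "(comm_with X Y ^^ m) Y \<subseteq> {\<one>}" unfolding X.nilpotent_action_def by blast
    moreover have "\<one> \<in> (comm_with X Y ^^ m) Y"
      using X.normal_iterate_comm_with[OF normalY normalY] by (auto dest: normal_imp_subgroup subgroup.one_closed)
    ultimately have "lower_central (X\<lparr>carrier := Y\<rparr>) m = {\<one>}"
      using X.lower_central_subgroup[OF subY] by blast
    then show ?thesis
      using X.subgroup_imp_group[OF subY] by (auto simp: nilpotent_group_def)
  qed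
  ultimately show ?thesis
    using subY X.is_group unfolding virtually_nilpotent_group_def by blast
qed

end

section \<open>The group \<open>weak_comm_group G\<close> as an instance\<close>

text \<open>Two endomorphisms \<open>u\<close>, \<open>v\<close> of \<open>G\<close> whose values at
  each \<open>g\<close> commute extend to the free product and kill the relators, hence factor
  through the quotient. The pairs (identity, trivial), (identity, identity) and (trivial, identity)
  give \<open>p\<close>, \<open>q\<close> and \<open>r\<close>.\<close>

lemma weakly_commuting_copies_weak_comm_group:
  assumes "group G"
  obtains f f' p q r where "weakly_commuting_copies (weak_comm_group G) G f f' p q r"
proof -
  let ?P = "free_product G G"
  let ?X = "weak_comm_group G"
  let ?N = "normal_closure ?P (weak_comm_relators G)"
  interpret G: group G by fact
  interpret P: group ?P by (rule group_free_product[OF assms assms])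
  have N: "?N \<lhd> ?P"
    by (rule normal_closure_normal[OF P.is_group weak_comm_relators_subset[OF assms]])
  have X: "?X = ?P Mod ?N" by (simp add: weak_comm_group_def)
  interpret \<pi>: group_hom ?P ?X "\<lambda>x. ?N #>\<^bsub>?P\<^esub> x" unfolding X by (rule P.hom_Mod[OF N])
  interpret i: group_hom G ?P "fp_inl G G"
    using fp_inl_hom[OF assms] P.is_group assms by (simp add: group_hom_def group_hom_axioms_def)
  interpret j: group_hom G ?P "fp_inr G G"
    using fp_inr_hom[OF assms] P.is_group assms by (simp add: group_hom_def group_hom_axioms_def)
  have relator: "commutator ?P (fp_inl G G g) (fp_inr G G g) \<in> ?N" if "g \<in> carrier G" for g
    using that unfolding normal_closure_def weak_comm_relators_def by blast
  have lift: "\<exists>h \<in> hom ?X G. (\<forall>g\<in>carrier G. h (?N #>\<^bsub>?P\<^esub> fp_inl G G g) = u g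
      \<and> h (?N #>\<^bsub>?P\<^esub> fp_inr G G g) = v g)"
    if uv: "u \<in> hom G G" "v \<in> hom G G"
      "\<And>g. g \<in> carrier G \<Longrightarrow> u g \<otimes>\<^bsub>G\<^esub> v g = v g \<otimes>\<^bsub>G\<^esub> u g" for u v
  proof -
    obtain h where h: "h \<in> hom ?P G" "\<And>g. g \<in> carrier G \<Longrightarrow> h (fp_inl G G g) = u g"
      "\<And>g. g \<in> carrier G \<Longrightarrow> h (fp_inr G G g) = v g"
      using free_product_universal[OF assms assms assms uv(1,2)] by blast
    interpret h: group_hom ?P G h
      using h(1) by unfold_locales
    have "weak_comm_relators G \<subseteq> kernel ?P G h"
    proof
      fix x assume "x \<in> weak_comm_relators G"
      then obtain g where g: "g \<in> carrier G" "x = commutator ?P (fp_inl G G g) (fp_inr G G g)"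
        by (auto simp: weak_comm_relators_def)
      then have "h x = commutator G (u g) (v g)" by (simp add: h.hom_commutator h)
      also have "\<dots> = \<one>\<^bsub>G\<^esub>"
        using uv g by (simp add: G.commutator_eq_one_iff hom_in_carrier)
      finally show "x \<in> kernel ?P G h" using g by (simp add: kernel_def)
    qed
    then have "?N \<subseteq> kernel ?P G h"
      using h.normal_kernel unfolding normal_closure_def by blast
    then obtain k where "k \<in> hom (?P Mod ?N) G"
      "\<And>x. x \<in> carrier ?P \<Longrightarrow> k (?N #>\<^bsub>?P\<^esub> x) = h x"
      using h.FactGroup_universal_kernel[OF N] by blast
    then show ?thesis using h unfolding X by (intro bexI[of _ k]) simp_all
  qed
  have id: "(\<lambda>g. g) \<in> hom G G" and one: "(\<lambda>g. \<one>\<^bsub>G\<^esub>) \<in> hom G G" by (auto simp: hom_def)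
  obtain p where p: "p \<in> hom ?X G" "\<And>g. g \<in> carrier G \<Longrightarrow> p (?N #>\<^bsub>?P\<^esub> fp_inl G G g) = g"
      "\<And>g. g \<in> carrier G \<Longrightarrow> p (?N #>\<^bsub>?P\<^esub> fp_inr G G g) = \<one>\<^bsub>G\<^esub>"
    using lift[OF id one] by auto
  obtain q where q: "q \<in> hom ?X G" "\<And>g. g \<in> carrier G \<Longrightarrow> q (?N #>\<^bsub>?P\<^esub> fp_inl G G g) = g"
      "\<And>g. g \<in> carrier G \<Longrightarrow> q (?N #>\<^bsub>?P\<^esub> fp_inr G G g) = g"
    using lift[OF id id] by auto
  obtain r where r: "r \<in> hom ?X G" "\<And>g. g \<in> carrier G \<Longrightarrow> r (?N #>\<^bsub>?P\<^esub> fp_inl G G g) = \<one>\<^bsub>G\<^esub>"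
      "\<And>g. g \<in> carrier G \<Longrightarrow> r (?N #>\<^bsub>?P\<^esub> fp_inr G G g) = g"
    using lift[OF one id] by auto
  let ?f = "\<lambda>g. ?N #>\<^bsub>?P\<^esub> fp_inl G G g"
  let ?f' = "\<lambda>g. ?N #>\<^bsub>?P\<^esub> fp_inr G G g"
  have "weakly_commuting_copies ?X G ?f ?f' p q r"
  proof
    show "?f \<in> hom G ?X" "?f' \<in> hom G ?X" by (auto simp: hom_def simp del: mult_FactGroup)
    let ?S = "fp_inl G G ` carrier G \<union> fp_inr G G ` carrier G"
    have "?S \<subseteq> carrier ?P" by auto
    then have "generate ?X ((\<lambda>x. ?N #>\<^bsub>?P\<^esub> x) ` ?S) = (\<lambda>x. ?N #>\<^bsub>?P\<^esub> x) ` carrier ?P"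
      using \<pi>.generate_img free_product_generated[OF assms assms] by metis
    also have "\<dots> = carrier ?X" unfolding X by (auto simp: carrier_FactGroup)
    finally show "generate ?X (?f ` carrier G \<union> ?f' ` carrier G) = carrier ?X"
      by (simp add: image_Un image_image)
    show "?f g \<otimes>\<^bsub>?X\<^esub> ?f' g = ?f' g \<otimes>\<^bsub>?X\<^esub> ?f g" if "g \<in> carrier G" for g
      using P.commutator_in_normal_iff[OF N] relator[OF that] that unfolding X by simp
  qed (use p q r in auto)
  then show thesis by (rule that)
qed

theorem theoremD:
  fixes G :: "('a, 'b) monoid_scheme"
  assumes "group G"
    and "finitely_generated_group G"
    and "virtually_nilpotent_group G"
  shows "virtually_nilpotent_group (weak_comm_group G)"
proof -
  obtain f f' p q r where "weakly_commuting_copies (weak_comm_group G) G f f' p q r"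
    using weakly_commuting_copies_weak_comm_group[OF assms(1)] by blast
  then show ?thesis using assms(2,3) by (rule weakly_commuting_copies.virtually_nilpotent)
qed

end
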